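(* Let $A$ be a C*-algebra. Then the following are equivalent: (1) $A=\widetilde{A}[A,A]\widetilde{A}$, i.e. $A$ is generated by its commutators as a (not necessarily closed) ideal; (2) $A=A[A,A]A$, i.e. for every $a\in A$ there exist $n\in\mathbb{N}$ and $b_j,c_j,d_j,e_j\in A$ with $a=\sum_{j=1}^n b_j[c_j,d_j]e_j$; (3) $A=A\big[[A,A],[A,A]\big]A$; (4) $A$ is generated by its commutators as a ring; (5) $A=[A,A]^2$, i.e. for every $a\in A$ there exist $n\in\mathbb{N}$ and $b_j,c_j,d_j,e_j\in A$ with $a=\sum_{j=1}^n[b_j,c_j][d_j,e_j]$. Moreover, these conditions imply (6) $A$ admits no character. Further, (6) implies that $A[A,A]A$ is norm-dense in $A$, and thus all conditions (1)–(6) are equivalent if $A$ is unital.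
   Context: For $x,y\in A$, $[x,y]=xy-yx$. For subsets $X,Y$, $[X,Y]$ is the additive subgroup generated by all $[x,y]$ ($x\in X,y\in Y$), $XY$ is the additive subgroup generated by all products $xy$, $X^2=XX$, and $XYZ=(XY)Z$; no closures are taken. $\widetilde{A}$ denotes the minimal unitization of $A$ ($\widetilde A=A$ if $A$ is unital). A character on $A$ is a one-dimensional irreducible representation, equivalently a nonzero homomorphism $A\to\mathbb{C}$. *)

theory Defs
  imports "HOL-Analysis.Analysis"
begin

class cstar_algebra = real_normed_algebra + banach +
  fixes cscale :: "complex \<Rightarrow> 'a \<Rightarrow> 'a"
    and cstar :: "'a \<Rightarrow> 'a"
  assumes cscale_add_right: "cscale c (x + y) = cscale c x + cscale c y"
    and cscale_add_left: "cscale (c + d) x = cscale c x + cscale d x"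
    and cscale_cscale: "cscale c (cscale d x) = cscale (c * d) x"
    and cscale_one: "cscale 1 x = x"
    and cscale_of_real: "cscale (complex_of_real r) x = scaleR r x"
    and cscale_mult_left: "cscale c (x * y) = cscale c x * y"
    and cscale_mult_right: "cscale c (x * y) = x * cscale c y"
    and norm_cscale: "norm (cscale c x) = cmod c * norm x"
    and cstar_add: "cstar (x + y) = cstar x + cstar y"
    and cstar_cscale: "cstar (cscale c x) = cscale (cnj c) (cstar x)"
    and cstar_mult: "cstar (x * y) = cstar y * cstar x"
    and cstar_cstar: "cstar (cstar x) = x"
    and cstar_identity: "norm (cstar x * x) = (norm x)\<^sup>2"

definition add_gen :: "'a::ab_group_add set \<Rightarrow> 'a set" where
  "add_gen S = {x. \<exists>xs. set xs \<subseteq> S \<union> uminus ` S \<and> x = sum_list xs}"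

definition commutator :: "'a::ring \<Rightarrow> 'a \<Rightarrow> 'a" where
  "commutator x y = x * y - y * x"

definition comm_set :: "'a::ring set \<Rightarrow> 'a set \<Rightarrow> 'a set" where
  "comm_set X Y = add_gen {commutator x y | x y. x \<in> X \<and> y \<in> Y}"

definition prod_set :: "'a::ring set \<Rightarrow> 'a set \<Rightarrow> 'a set" where
  "prod_set X Y = add_gen {x * y | x y. x \<in> X \<and> y \<in> Y}"

text \<open>Products with the minimal unitization on both sides:
  \<open>\<tilde>A X \<tilde>A\<close> as a subset of A. An element of the unitization acts as
  \<open>\<lambda>1 + a\<close> (\<lambda> complex, a \<in> A); if A is unital this is again an element of A,
  so the same formula covers \<open>\<tilde>A = A\<close> in the unital case.\<close>
definition unitization_sandwich :: "'a::cstar_algebra set \<Rightarrow> 'a set" where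
  "unitization_sandwich X = add_gen
     {cscale l (cscale m x) + cscale l (x * b) + cscale m (a * x) + a * x * b
        | l m a b x. x \<in> X}"

inductive_set ring_gen :: "'a::ring set \<Rightarrow> 'a set" for S where
  base: "x \<in> S \<Longrightarrow> x \<in> ring_gen S"
| zero: "0 \<in> ring_gen S"
| diff: "x \<in> ring_gen S \<Longrightarrow> y \<in> ring_gen S \<Longrightarrow> x - y \<in> ring_gen S"
| mult: "x \<in> ring_gen S \<Longrightarrow> y \<in> ring_gen S \<Longrightarrow> x * y \<in> ring_gen S"

definition is_character :: "('a::cstar_algebra \<Rightarrow> complex) \<Rightarrow> bool" where
  "is_character \<phi> \<longleftrightarrow>
     (\<forall>x y. \<phi> (x + y) = \<phi> x + \<phi> y) \<and>
     (\<forall>c x. \<phi> (cscale c x) = c * \<phi> x) \<and>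
     (\<forall>x y. \<phi> (x * y) = \<phi> x * \<phi> y) \<and>
     (\<exists>x. \<phi> x \<noteq> 0)"

definition unital_alg :: "'a::ring itself \<Rightarrow> bool" where
  "unital_alg _ \<longleftrightarrow> (\<exists>e::'a. \<forall>x. e * x = x \<and> x * e = x)"

end

theory Submission
  imports Defs "HOL-Complex_Analysis.Complex_Analysis" "HOL-Real_Asymp.Real_Asymp"
begin

text \<open>The implications are proved in the cycle (1), (2), (3), (5), (4), (1). A continuous functional calculus
  for selfadjoint h of norm less than 1 supplies the analysis. It rests on the bound
  \<open>\<parallel>p(h)\<parallel> \<le> sup |p|\<close> over \<open>[-1,1]\<close>: h is the real part of the isometry
  \<open>U = h + \<i> sqrt (1 - h\<^sup>2)\<close>, so p(h) is a Laurent polynomial in U whose coefficients are bounded by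
  sup |p|. This gives the bound up to a factor linear in the degree, and the identity
  \<open>\<parallel>y\<^sup>2\<parallel> = \<parallel>y\<parallel>\<^sup>2\<close> for selfadjoint y removes the factor.

  (1) implies (2) since every h is a product of three elements. For (2) implies (3) write
  h = \<open>x\<^sup>n y\<^sub>n\<close> for all n with one x, namely x = 1 / (1 - ln |h|). Hence a proper ideal, closed or not,
  lies in a proper prime ideal, and modulo a prime ideal containing \<open>[L,L]\<close>, where \<open>L = [A,A]\<close>, all commutators
  vanish by Herstein's computation. For (3) implies (5) one shows that A \<open>[L,L]\<close> A lies in L + LL
  and then that L lies in LL.

  If J, the closure of A L A, is proper, choose e, g in A with e g = g not in J. An ideal that
  contains J and all y - e y and is maximal with respect to not containing e is the kernel of a
  character, because selfadjoint elements are real multiples of e modulo it.\<close>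

section \<open>Complex scalars and the involution\<close>

lemma cscale_zero_left [simp]: "cscale 0 (x::'a::cstar_algebra) = 0"
  using norm_cscale[of 0 x] by simp

lemma cscale_zero_right [simp]: "cscale c (0::'a::cstar_algebra) = 0"
  using norm_cscale[of c "0::'a"] by simp

lemma cscale_minus_left: "cscale (- c) (x::'a::cstar_algebra) = - cscale c x"
  using cscale_add_left[of c "- c" x] by (simp add: eq_neg_iff_add_eq_0 add.commute)

lemma cscale_minus_right: "cscale c (- x::'a::cstar_algebra) = - cscale c x"
  using cscale_add_right[of c x "- x"] by (simp add: eq_neg_iff_add_eq_0 add.commute)

lemma cscale_diff_right: "cscale c (x - y::'a::cstar_algebra) = cscale c x - cscale c y"
  using cscale_add_right[of c x "- y"] by (simp add: cscale_minus_right)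

lemma cscale_diff_left: "cscale (c - d) (x::'a::cstar_algebra) = cscale c x - cscale d x"
  using cscale_add_left[of c "- d" x] by (simp add: cscale_minus_left)

lemma cscale_mult_right': "x * cscale c (y::'a::cstar_algebra) = cscale c (x * y)"
  by (simp add: cscale_mult_right)

lemma cscale_mult_left': "cscale c x * (y::'a::cstar_algebra) = cscale c (x * y)"
  by (simp add: cscale_mult_left)

lemmas cscale_linear = cscale_add_right cscale_add_left cscale_diff_right cscale_diff_left
  cscale_minus_right cscale_minus_left

lemma cstar_zero [simp]: "cstar (0::'a::cstar_algebra) = 0"
  using cstar_add[of "0::'a" 0] by simp

lemma cstar_minus: "cstar (- x::'a::cstar_algebra) = - cstar x"
  using cstar_add[of x "- x"] by (simp add: eq_neg_iff_add_eq_0 add.commute)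

lemma cstar_diff: "cstar (x - y::'a::cstar_algebra) = cstar x - cstar y"
  using cstar_add[of x "- y"] by (simp add: cstar_minus)

lemma cstar_scaleR: "cstar (r *\<^sub>R x::'a::cstar_algebra) = r *\<^sub>R cstar x"
  by (metis cscale_of_real cstar_cscale complex_cnj_complex_of_real)

text \<open>The C*-identity and submultiplicativity give norm x squared at most
  \<open>norm (cstar x) * norm x\<close>; dividing and exchanging x with its adjoint gives both
  inequalities.\<close>

lemma norm_cstar [simp]: "norm (cstar x) = norm (x::'a::cstar_algebra)"
proof -
  have *: "norm x \<le> norm (cstar x)" for x :: 'a
  proof (cases "x = 0")
    case False
    have "norm x * norm x \<le> norm (cstar x) * norm x"
      using norm_mult_ineq[of "cstar x" x] by (simp add: cstar_identity power2_eq_square)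
    then show ?thesis using False by simp
  qed simp
  show ?thesis using *[of x] *[of "cstar x"] by (simp add: cstar_cstar)
qed

lemma norm_square_selfadjoint: "cstar x = x \<Longrightarrow> norm (x * x) = (norm (x::'a::cstar_algebra))\<^sup>2"
  using cstar_identity[of x] by simp

lemma bounded_linear_cstar: "bounded_linear (cstar :: 'a::cstar_algebra \<Rightarrow> 'a)"
  by (rule bounded_linear_intro[of _ 1]) (simp_all add: cstar_add cstar_scaleR)

lemmas tendsto_cstar = bounded_linear.tendsto[OF bounded_linear_cstar]

section \<open>Norm bounds for polynomials in a selfadjoint element\<close>

text \<open>The vector q(U) x, computed by the Horner scheme. \<open>U\<close> is a map on the
  algebra and not an element of it, because the isometry to be inserted later involves the identity
  and is available only through its left multiplication.\<close>

definition op_eval :: "('a::cstar_algebra \<Rightarrow> 'a) \<Rightarrow> complex poly \<Rightarrow> 'a \<Rightarrow> 'a" where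
  "op_eval U q x = foldr (\<lambda>a y. cscale a x + U y) (coeffs q) 0"

context
  fixes U :: "'a::cstar_algebra \<Rightarrow> 'a"
  assumes U_add: "U (x + y) = U x + U y"
    and U_cscale: "U (cscale c x) = cscale c (U x)"
begin

lemma op_zero: "U 0 = 0"
  using U_add[of 0 0] by simp

lemma op_eval_0 [simp]: "op_eval U 0 x = 0"
  by (simp add: op_eval_def)

lemma op_eval_pCons [simp]: "op_eval U (pCons a q) x = cscale a x + U (op_eval U q x)"
  by (cases "a = 0 \<and> q = 0") (auto simp: op_eval_def cCons_def op_zero)

lemma op_eval_add: "op_eval U (p + q) x = op_eval U p x + op_eval U q x"
  by (induction p q rule: poly_induct2) (simp_all add: cscale_linear U_add)

lemma op_eval_smult: "op_eval U (smult c q) x = cscale c (op_eval U q x)"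
  by (induction q) (simp_all add: cscale_linear cscale_cscale U_cscale)

lemma op_eval_mult: "op_eval U (p * q) x = op_eval U p (op_eval U q x)"
  by (induction p) (simp_all add: op_eval_add op_eval_smult)

lemma op_eval_monom: "op_eval U (monom 1 n) x = (U ^^ n) x"
  by (induction n) (simp_all add: monom_0 monom_Suc cscale_one op_zero)

text \<open>Triangle inequality: at most \<open>degree q + 1\<close> terms, each of norm at most
  \<open>B * norm x\<close> because \<open>U\<close> is isometric.\<close>

lemma norm_op_eval_le:
  fixes B :: real
  assumes iso: "\<And>x. norm (U x) = norm x" and B: "\<And>k. cmod (coeff q k) \<le> B"
  shows "norm (op_eval U q x) \<le> (degree q + 1) * B * norm x"
proof -
  have B0: "0 \<le> B" using norm_ge_zero order_trans B by blast
  have "norm (foldr (\<lambda>a y. cscale a x + U y) as 0) \<le> length as * B * norm x"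
    if "\<And>a. a \<in> set as \<Longrightarrow> cmod a \<le> B" for as :: "complex list"
    using that
  proof (induction as)
    case (Cons a as)
    have "norm (cscale a x + U (foldr (\<lambda>a y. cscale a x + U y) as 0)) \<le>
       B * norm x + length as * B * norm x"
      using Cons by (intro norm_triangle_le add_mono) (auto simp: norm_cscale iso intro!: mult_right_mono)
    then show ?case by (simp add: algebra_simps)
  qed simp
  moreover have "cmod a \<le> B" if "a \<in> set (coeffs q)" for a
    using that B by (auto simp: coeffs_def split: if_splits)
  ultimately have "norm (op_eval U q x) \<le> length (coeffs q) * B * norm x"
    unfolding op_eval_def by blast
  also have "\<dots> \<le> (degree q + 1) * B * norm x"
    using B0 by (intro mult_right_mono) (cases "q = 0", auto simp: length_coeffs)
  finally show ?thesis .
qed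

end

lemma higher_deriv_poly: "(deriv ^^ k) (poly q) = poly ((pderiv ^^ k) q)" for q :: "complex poly"
  by (induction k) (auto intro!: DERIV_imp_deriv)

text \<open>Cauchy's estimate for the k-th derivative at 0 on the unit circle; that derivative is
  \<open>fact k * coeff q k\<close>.\<close>

lemma coeff_le_sup_circle:
  fixes q :: "complex poly"
  assumes "\<And>z. cmod z = 1 \<Longrightarrow> cmod (poly q z) \<le> B"
  shows "cmod (coeff q k) \<le> B"
proof -
  have "norm ((deriv ^^ k) (poly q) 0) \<le> fact k * B / 1 ^ k"
    by (rule Cauchy_inequality) (use assms in \<open>auto intro!: holomorphic_intros continuous_intros\<close>)
  moreover have "(deriv ^^ k) (poly q) 0 = fact k * coeff q k"
    by (simp add: higher_deriv_poly poly_0_coeff_0 coeff_higher_pderiv pochhammer_fact)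
  ultimately show ?thesis by (simp add: norm_mult)
qed

text \<open>Here s stands for sqrt (\<open>1 - h\<^sup>2\<close>) - 1: the last equation says that 1
  + s squares to \<open>1 - h\<^sup>2\<close>, without naming a unit. It is the fixed point of
  \<open>F\<close>, which contracts with constant \<open>norm h\<close> on the selfadjoint elements
  of norm at most \<open>norm h\<close> that commute with h.\<close>

lemma exists_one_minus_sqrt:
  fixes h :: "'a::cstar_algebra"
  assumes sa: "cstar h = h" and h1: "norm h < 1"
  obtains s where "cstar s = s" "s * h = h * s" "s * s + 2 *\<^sub>R s + h * h = 0"
proof -
  define S where "S = {s::'a. norm s \<le> norm h \<and> cstar s = s \<and> s * h = h * s}"
  define F where "F s = - ((1/2) *\<^sub>R (h * h + s * s))" for s :: 'a
  have "closed S"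
    unfolding S_def
    by (intro closed_Collect_conj closed_Collect_le closed_Collect_eq continuous_intros
        linear_continuous_on bounded_linear_cstar)
  then have "complete S" by (simp add: complete_eq_closed)
  moreover have "F ` S \<subseteq> S"
  proof
    fix y assume "y \<in> F ` S"
    then obtain s where s: "norm s \<le> norm h" "cstar s = s" "s * h = h * s" and y: "y = F s"
      by (auto simp: S_def)
    have "norm (s * s) \<le> norm h * norm h"
      by (meson norm_mult_ineq order_trans mult_mono s(1) norm_ge_zero)
    then have "norm (h * h + s * s) \<le> 2 * (norm h * norm h)"
      using norm_triangle_ineq[of "h * h" "s * s"] norm_mult_ineq[of h h] by linarith
    then have "norm y \<le> norm h * norm h" by (simp add: y F_def)
    also have "\<dots> \<le> norm h" using h1 by (simp add: mult_left_le_one_le)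
    finally have "norm y \<le> norm h" .
    moreover have "cstar y = y"
      by (simp add: y F_def cstar_minus cstar_scaleR cstar_add cstar_mult sa s)
    moreover have "s * s * h = h * (s * s)" using s(3) by (metis mult.assoc)
    then have "y * h = h * y"
      by (simp add: y F_def algebra_simps)
    ultimately show "y \<in> S" by (simp add: S_def)
  qed
  moreover have "dist (F s) (F t) \<le> norm h * dist s t" if "s \<in> S" "t \<in> S" for s t
  proof -
    have "F s - F t = (1/2) *\<^sub>R (t * (t - s) + (t - s) * s)"
    proof -
      have "t * (t - s) + (t - s) * s = t * t - s * s" by (simp add: algebra_simps)
      then show ?thesis by (simp only: F_def) (simp add: scaleR_diff_right scaleR_add_right)
    qed
    also have "norm \<dots> \<le> (1/2) * (norm t * norm (t - s) + norm (t - s) * norm s)"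
      by (simp, intro norm_triangle_le add_mono norm_mult_ineq)
    also have "\<dots> \<le> (1/2) * (norm h * norm (t - s) + norm (t - s) * norm h)"
      using that by (intro mult_left_mono add_mono mult_right_mono) (auto simp: S_def)
    finally show ?thesis by (simp add: dist_norm norm_minus_commute)
  qed
  ultimately have "\<exists>!s\<in>S. F s = s"
    using h1 by (intro Banach_fix[where c = "norm h"]) (auto simp: S_def intro: exI[of _ 0])
  then obtain s where "s \<in> S" "F s = s" by blast
  then have "s * s + 2 *\<^sub>R s + h * h = s * s + 2 *\<^sub>R F s + h * h" "cstar s = s" "s * h = h * s"
    by (auto simp: S_def)
  then show ?thesis by (intro that[of s]) (auto simp: F_def)
qed

text \<open>Pairs a real polynomial function without constant term with its value at h. It is a
  relation because one function may arise from several expressions; that their values agree follows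
  only from the norm bound below.\<close>

inductive poly_calc :: "'a::cstar_algebra \<Rightarrow> (real \<Rightarrow> real) \<Rightarrow> 'a \<Rightarrow> bool" for h where
  ident: "poly_calc h (\<lambda>t. t) h"
| scale: "poly_calc h f y \<Longrightarrow> poly_calc h (\<lambda>t. c * f t) (c *\<^sub>R y)"
| add: "poly_calc h f y \<Longrightarrow> poly_calc h g z \<Longrightarrow> poly_calc h (\<lambda>t. f t + g t) (y + z)"
| mult: "poly_calc h f y \<Longrightarrow> poly_calc h g z \<Longrightarrow> poly_calc h (\<lambda>t. f t * g t) (y * z)"

lemma poly_calc_continuous: "poly_calc h f y \<Longrightarrow> continuous_on S f"
  by (induction rule: poly_calc.induct) (auto intro!: continuous_intros)

lemma poly_calc_commute:
  assumes "poly_calc h f y" "s * h = h * s"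
  shows "s * y = y * s"
  using assms by (induction rule: poly_calc.induct) (auto simp: algebra_simps, metis mult.assoc)

lemma poly_calc_selfadjoint:
  assumes "poly_calc h f y" "cstar h = h"
  shows "cstar y = y"
  using assms(1)
proof (induction rule: poly_calc.induct)
  case (mult f y g z)
  have "h * y = y * h" using poly_calc_commute[OF mult(1)] by metis
  then have "y * z = z * y" using poly_calc_commute[OF mult(2), of y] by simp
  then show ?case using mult by (simp add: cstar_mult)
qed (simp_all add: assms cstar_scaleR cstar_add)

text \<open>Exponential growth beats linear growth along the exponents \<open>2 ^ n\<close>. This
  removes the factor linear in the degree from the norm bound.\<close>

lemma power_two_power_gt_linear:
  fixes r c d :: real
  assumes "1 < r"
  obtains n :: nat where "c * 2 ^ n + d < r ^ (2 ^ n)"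
proof -
  have "eventually (\<lambda>N::nat. c * N + d < r ^ N) at_top"
    using assms by real_asymp
  moreover have "filterlim (\<lambda>n::nat. (2::nat) ^ n) at_top at_top"
    by (rule filterlim_subseq) (simp add: strict_mono_def)
  ultimately have "eventually (\<lambda>n::nat. c * real (2 ^ n) + d < r ^ (2 ^ n)) at_top"
    unfolding filterlim_iff by blast
  then obtain n :: nat where "c * real (2 ^ n) + d < r ^ (2 ^ n)"
    using eventually_happens'[OF sequentially_bot] by blast
  then show ?thesis by (intro that[of n]) simp
qed

text \<open>This bound takes the place of spectral theory: it makes the functional calculus
  single-valued and continuous for the supremum norm on the interval.\<close>

lemma poly_calc_norm_le:
  assumes sa: "cstar h = h" and h1: "norm h < 1" and pc: "poly_calc h f y"
    and M: "\<And>t. t \<in> {-1..1} \<Longrightarrow> \<bar>f t\<bar> \<le> M"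
  shows "norm y \<le> M"
proof -
  obtain s where s: "cstar s = s" "s * h = h * s" "s * s + 2 *\<^sub>R s + h * h = 0"
    using exists_one_minus_sqrt[OF sa h1] .
  \<comment> \<open>Left multiplication by h + \<i> (1 + s), a unitary with real part h;
    \<open>V\<close> below is left multiplication by its adjoint.\<close>
  define U where "U x = h * x + cscale \<i> (x + s * x)" for x
  have U_add: "U (x + y) = U x + U y" for x y
    by (simp add: U_def algebra_simps cscale_linear)
  have U_cscale: "U (cscale c x) = cscale c (U x)" for c x
    by (simp add: U_def cscale_linear cscale_mult_right' cscale_cscale mult.commute)
  define V where "V x = h * x - cscale \<i> (x + s * x)" for x
  \<comment> \<open>This is \<open>h\<^sup>2 + (1 + s)\<^sup>2 = 1\<close>, applied to x. It yields
    both that \<open>V\<close> is a right inverse of \<open>U\<close> and that \<open>U\<close> is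
    isometric.\<close>
  have expand: "h * (h * x) + (x + s * x) + s * (x + s * x) = x" for x
  proof -
    have "h * (h * x) + (x + s * x) + s * (x + s * x) = x + (s * s + 2 *\<^sub>R s + h * h) * x"
      by (simp add: algebra_simps scaleR_2)
    then show ?thesis by (simp add: s)
  qed
  have sh: "s * (h * x) = h * (s * x)" for x by (metis s(2) mult.assoc)
  have UV: "U (V x) = x" for x
  proof -
    have "U (V x) = h * (h * x) + (x + s * x) + s * (x + s * x)"
      by (simp add: U_def V_def algebra_simps cscale_linear cscale_mult_right' cscale_cscale
          cscale_one sh)
    then show ?thesis using expand by simp
  qed
  have iso: "norm (U x) = norm x" for x
  proof -
    have "cstar (U x) * U x = cstar x * (h * (h * x) + (x + s * x) + s * (x + s * x))"
      by (simp add: U_def algebra_simps cscale_linear cscale_mult_right' cscale_mult_left' cscale_cscale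
          cscale_one sh cstar_add cstar_mult cstar_cscale s sa)
    then have "(norm (U x))\<^sup>2 = (norm x)\<^sup>2" by (metis cstar_identity expand)
    then show ?thesis by simp
  qed
  \<comment> \<open>Since h is half the sum of U and its inverse, multiplying by U clears the
    negative power.\<close>
  have U_h: "U (h * x) = (1/2) *\<^sub>R (x + U (U x))" for x
  proof -
    have "U x + V x = 2 *\<^sub>R (h * x)" by (simp add: U_def V_def scaleR_2)
    then have "U (U x) + x = U (2 *\<^sub>R (h * x))" by (metis U_add UV)
    also have "\<dots> = 2 *\<^sub>R U (h * x)" by (simp add: scaleR_2 U_add)
    finally show ?thesis by (simp add: add.commute)
  qed
  note E = op_eval_add[OF U_add U_cscale] op_eval_smult[OF U_add U_cscale]
    op_eval_mult[OF U_add U_cscale] op_eval_monom[OF U_add U_cscale]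
    op_eval_pCons[OF U_add U_cscale] op_eval_0[OF U_add U_cscale] op_zero[OF U_add U_cscale]
  have pow_add: "(U ^^ n) (x + y) = (U ^^ n) x + (U ^^ n) y" for n x y
    by (induction n) (simp_all add: U_add)
  have pow_scale: "(U ^^ n) (c *\<^sub>R x) = cscale (of_real c) ((U ^^ n) x)" for n c x
    by (induction n) (simp_all add: U_cscale flip: cscale_of_real)
  \<comment> \<open>\<open>R f y D q\<close> says that y is the Laurent polynomial q(z) /
    \<open>z ^ D\<close> evaluated at U, and that on the unit circle this Laurent polynomial equals
    f (Re z). The shift by D keeps all exponents nonnegative.\<close>
  define R where "R f y D q \<longleftrightarrow> degree q \<le> 2 * D \<and>
      (\<forall>z. cmod z = 1 \<longrightarrow> poly q z = z ^ D * complex_of_real (f (Re z))) \<and>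
      (\<forall>x. (U ^^ D) (y * x) = op_eval U q x)" for f y D q
  have R_mult: "R (\<lambda>t. f t * g t) (y * z) (D + D') (q * q')"
    if pc: "poly_calc h f y" and R: "R f y D q" "R g z D' q'" for f g y z D D' q q'
  proof -
    have "U (y * x) = y * U x" for x
    proof -
      have "h * (y * x) = y * (h * x)" "s * (y * x) = y * (s * x)"
        by (metis poly_calc_commute[OF pc] s(2) mult.assoc)+
      then show ?thesis by (simp add: U_def algebra_simps cscale_mult_right')
    qed
    then have "(U ^^ D') (y * x) = y * (U ^^ D') x" for x
      by (induction D') auto
    then have "(U ^^ (D + D')) (y * z * x) = op_eval U (q * q') x" for x
      using R by (simp add: R_def funpow_add E mult.assoc)
    then show ?thesis
      using R degree_mult_le[of q q'] by (simp add: R_def power_add)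
  qed
  have "\<exists>D q. R f y D q" if "poly_calc h f y" for f y
    using that
  proof (induction rule: poly_calc.induct)
    case ident
    \<comment> \<open>On the unit circle \<open>cnj z\<close> is the inverse of z, so Re z is
      represented by (1 + \<open>z\<^sup>2\<close>) / 2 with shift 1.\<close>
    have "1 + z * z = 2 * (z * complex_of_real (Re z))" if "cmod z = 1" for z
    proof -
      have "1 = z * cnj z" using complex_norm_square[of z] that by simp
      then have "1 + z * z = z * (z + cnj z)" by (simp add: algebra_simps)
      then show ?thesis by (simp add: complex_add_cnj)
    qed
    then have "1 / 2 + z * z / 2 = z * complex_of_real (Re z)" if "cmod z = 1" for z
      using that by (simp add: field_simps)
    moreover have "(1/2) *\<^sub>R x = cscale (1/2) x" for x :: 'a
      using cscale_of_real[of "1/2" x] by simp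
    ultimately have "R (\<lambda>t. t) h 1 (smult (1/2) [:1, 0, 1:])"
      by (simp add: R_def U_h E cscale_one U_add U_cscale cscale_linear)
    then show ?case by blast
  next
    case (scale f y c)
    then obtain D q where "R f y D q" by blast
    then have "R (\<lambda>t. c * f t) (c *\<^sub>R y) D (smult (of_real c) q)"
      by (auto simp: R_def E pow_scale)
    then show ?case by blast
  next
    case (add f y g z)
    then obtain D q D' q' where R: "R f y D q" "R g z D' q'" by blast
    \<comment> \<open>The summands are brought to the common shift \<open>D + D'\<close> by
      multiplying each polynomial with the missing power of the variable.\<close>
    have "(U ^^ (D + D')) ((y + z) * x) = op_eval U (monom 1 D' * q + monom 1 D * q') x" for x
    proof -
      have "(U ^^ (D + D')) ((y + z) * x) = (U ^^ (D' + D)) (y * x) + (U ^^ (D + D')) (z * x)"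
        by (simp add: pow_add distrib_right add.commute)
      then show ?thesis using R by (simp add: R_def funpow_add E)
    qed
    moreover have "degree (monom 1 D' * q + monom 1 D * q') \<le> 2 * (D + D')"
      using R degree_mult_le[of "monom 1 D'" q] degree_mult_le[of "monom 1 D" q']
      by (intro degree_add_le) (auto simp: R_def degree_monom_eq)
    ultimately have "R (\<lambda>t. f t + g t) (y + z) (D + D') (monom 1 D' * q + monom 1 D * q')"
      using R by (simp add: R_def poly_monom power_add algebra_simps)
    then show ?case by blast
  next
    case (mult f y g z)
    then show ?case using R_mult by blast
  qed
  then obtain D q where R0: "R f y D q" using pc by blast
  \<comment> \<open>The relation \<open>R\<close> is evaluated at x = y in place of a unit:
    \<open>U ^^ D\<close> preserves the norm of y * y, which is the square of \<open>norm y\<close>,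
    and one factor \<open>norm y\<close> cancels.\<close>
  have crude: "norm y \<le> (2 * D + 1) * B"
    if pc: "poly_calc h f y" and R: "R f y D q" and B: "\<And>t. t \<in> {-1..1} \<Longrightarrow> \<bar>f t\<bar> \<le> B" for f y D q B
  proof -
    have B0: "0 \<le> B" using B[of 0] by simp
    have "cmod (poly q z) \<le> B" if "cmod z = 1" for z
      using R B[of "Re z"] abs_Re_le_cmod[of z] that by (simp add: R_def norm_mult norm_power abs_le_iff)
    then have cf: "cmod (coeff q k) \<le> B" for k by (rule coeff_le_sup_circle)
    have isoD: "norm ((U ^^ D) x) = norm x" for x
      by (induction D) (auto simp: iso)
    have "(norm y)\<^sup>2 = norm ((U ^^ D) (y * y))"
      using norm_square_selfadjoint[OF poly_calc_selfadjoint[OF pc sa]] isoD by simp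
    also have "\<dots> \<le> (degree q + 1) * B * norm y"
      using R norm_op_eval_le[OF U_add U_cscale iso cf, of y] by (simp add: R_def)
    also have "\<dots> \<le> (2 * D + 1) * B * norm y"
      using R B0 by (intro mult_right_mono) (auto simp: R_def)
    finally show ?thesis
      using B0 by (cases "y = 0") (auto simp: power2_eq_square add.commute)
  qed
  \<comment> \<open>Squaring n times raises f and \<open>norm y\<close> to the power
    \<open>2 ^ n\<close> exactly, since the elements are selfadjoint, while the shift D grows only
    by the factor \<open>2 ^ n\<close>.\<close>
  have squares: "\<exists>f' y' q'. poly_calc h f' y' \<and> R f' y' (D * 2 ^ n) q' \<and>
     norm y' = norm y ^ (2 ^ n) \<and> (\<forall>t. f' t = f t ^ (2 ^ n))" for n
  proof (induction n)
    case 0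
    then show ?case using R0 pc by auto
  next
    case (Suc n)
    then obtain f' y' q' where *: "poly_calc h f' y'" "R f' y' (D * 2 ^ n) q'"
      "norm y' = norm y ^ (2 ^ n)" "\<And>t. f' t = f t ^ (2 ^ n)" by blast
    have "norm (y' * y') = norm y ^ (2 ^ Suc n)"
      using norm_square_selfadjoint[OF poly_calc_selfadjoint[OF *(1) sa]] *(3)
      by (simp add: power_mult[symmetric] mult.commute)
    moreover have "f' t * f' t = f t ^ (2 ^ Suc n)" for t
      by (simp add: *(4) power_add[symmetric] mult_2)
    moreover have "R (\<lambda>t. f' t * f' t) (y' * y') (D * 2 ^ Suc n) (q' * q')"
      using R_mult[OF *(1,2,2)] by (simp add: algebra_simps mult_2)
    ultimately show ?case using poly_calc.mult[OF *(1,1)] by blast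
  qed
  have M0: "0 \<le> M" using M[of 0] by simp
  have bound: "norm y ^ (2 ^ n) \<le> (2 * D * 2 ^ n + 1) * M' ^ (2 ^ n)" if "M \<le> M'" for n and M' :: real
  proof -
    obtain f' y' q' where *: "poly_calc h f' y'" "R f' y' (D * 2 ^ n) q'"
      "norm y' = norm y ^ (2 ^ n)" "\<And>t. f' t = f t ^ (2 ^ n)" using squares by blast
    have "\<bar>f' t\<bar> \<le> M' ^ (2 ^ n)" if "t \<in> {-1..1}" for t
      using M[OF that] \<open>M \<le> M'\<close> by (simp add: * power_abs power_mono)
    from crude[OF *(1,2) this] show ?thesis by (simp add: * algebra_simps)
  qed
  show ?thesis
  proof (rule ccontr)
    assume "\<not> norm y \<le> M"
    \<comment> \<open>A bound strictly above M is positive even if M = 0, so dividing by it is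
      legitimate.\<close>
    then obtain M' where M': "M < M'" "M' < norm y" using dense by (metis not_le)
    then have "1 < norm y / M'" using M0 by simp
    then obtain n :: nat where "2 * real D * 2 ^ n + 1 < (norm y / M') ^ (2 ^ n)"
      by (rule power_two_power_gt_linear)
    moreover have "(norm y / M') ^ (2 ^ n) \<le> 2 * real D * 2 ^ n + 1"
      using bound[of M' n] M' M0 by (simp add: power_divide divide_le_eq add.commute)
    ultimately show False by simp
  qed
qed

section \<open>Continuous functional calculus\<close>

text \<open>Vanishing at 0 keeps the functional calculus inside an algebra that may have no unit;
  the interval contains the spectrum of every selfadjoint h of norm less than 1.\<close>

definition cont0 :: "(real \<Rightarrow> real) \<Rightarrow> bool" where
  "cont0 f \<longleftrightarrow> continuous_on {-1..1} f \<and> f 0 = 0"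

lemma cont0_intros [intro, simp]:
  "cont0 (\<lambda>t. t)"
  "cont0 (\<lambda>t. 0)"
  "cont0 f \<Longrightarrow> cont0 (\<lambda>t. c * f t)"
  "cont0 f \<Longrightarrow> cont0 g \<Longrightarrow> cont0 (\<lambda>t. f t + g t)"
  "cont0 f \<Longrightarrow> cont0 g \<Longrightarrow> cont0 (\<lambda>t. f t - g t)"
  "cont0 f \<Longrightarrow> cont0 g \<Longrightarrow> cont0 (\<lambda>t. f t * g t)"
  by (auto simp: cont0_def intro!: continuous_intros)

lemma cont0_bounded: "cont0 f \<Longrightarrow> bounded (f ` {-1..1})"
  by (simp add: cont0_def compact_imp_bounded compact_continuous_image)

locale sa_contraction =
  fixes h :: "'a::cstar_algebra"
  assumes sa: "cstar h = h" and norm_lt_1: "norm h < 1"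
begin

definition fc_rel :: "(real \<Rightarrow> real) \<Rightarrow> 'a \<Rightarrow> bool" where
  "fc_rel f y \<longleftrightarrow> (\<exists>g z. (\<forall>n. poly_calc h (g n) (z n)) \<and> uniform_limit {-1..1} g f sequentially
     \<and> z \<longlonglongrightarrow> y)"

definition fc :: "(real \<Rightarrow> real) \<Rightarrow> 'a" where
  "fc f = (THE y. fc_rel f y)"

lemma poly_calc_imp_fc_rel: "poly_calc h f y \<Longrightarrow> fc_rel f y"
  unfolding fc_rel_def by (rule exI[of _ "\<lambda>_. f"], rule exI[of _ "\<lambda>_. y"]) (auto intro: uniform_limit_const)

text \<open>A uniform limit of continuous functions is continuous on the compact interval.
  Boundedness is what the product rule for uniform limits asks for.\<close>

lemma fc_rel_bounded:
  assumes "fc_rel f y" shows "bounded (f ` {-1..1})"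
proof -
  obtain g z where "\<And>n. poly_calc h (g n) (z n)" "uniform_limit {-1..1} g f sequentially"
    using assms unfolding fc_rel_def by blast
  then have "continuous_on {-1..1} f"
    by (intro uniform_limit_theorem[of _ g sequentially]) (auto intro!: always_eventually poly_calc_continuous)
  then show ?thesis by (simp add: compact_imp_bounded compact_continuous_image)
qed

lemma fc_rel_add: "fc_rel f y \<Longrightarrow> fc_rel g z \<Longrightarrow> fc_rel (\<lambda>t. f t + g t) (y + z)"
  unfolding fc_rel_def
proof (elim exE conjE)
  fix fn yn gn zn
  assume "\<forall>n. poly_calc h (fn n) (yn n)" "uniform_limit {-1..1} fn f sequentially" "yn \<longlonglongrightarrow> y"
    "\<forall>n. poly_calc h (gn n) (zn n)" "uniform_limit {-1..1} gn g sequentially" "zn \<longlonglongrightarrow> z"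
  then show "\<exists>p w. (\<forall>n. poly_calc h (p n) (w n)) \<and>
      uniform_limit {-1..1} p (\<lambda>t. f t + g t) sequentially \<and> w \<longlonglongrightarrow> y + z"
    by (intro exI[of _ "\<lambda>n t. fn n t + gn n t"] exI[of _ "\<lambda>n. yn n + zn n"] conjI allI)
      (simp_all add: poly_calc.add uniform_limit_add tendsto_add)
qed

lemma fc_rel_mult:
  assumes fy: "fc_rel f y" and gz: "fc_rel g z"
  shows "fc_rel (\<lambda>t. f t * g t) (y * z)"
proof -
  obtain fn yn where "\<And>n. poly_calc h (fn n) (yn n)" "uniform_limit {-1..1} fn f sequentially"
    "yn \<longlonglongrightarrow> y" using fy unfolding fc_rel_def by blast
  moreover obtain gn zn where "\<And>n. poly_calc h (gn n) (zn n)" "uniform_limit {-1..1} gn g sequentially"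
    "zn \<longlonglongrightarrow> z" using gz unfolding fc_rel_def by blast
  ultimately show ?thesis
    using fc_rel_bounded[OF fy] fc_rel_bounded[OF gz] unfolding fc_rel_def
    by (intro exI[of _ "\<lambda>n t. fn n t * gn n t"] exI[of _ "\<lambda>n. yn n * zn n"])
      (auto intro: poly_calc.mult uniform_lim_mult tendsto_mult)
qed

lemma fc_rel_scale: "fc_rel f y \<Longrightarrow> fc_rel (\<lambda>t. c * f t) (c *\<^sub>R y)"
  unfolding fc_rel_def
proof (elim exE conjE)
  fix fn yn
  assume "\<forall>n. poly_calc h (fn n) (yn n)" "uniform_limit {-1..1} fn f sequentially" "yn \<longlonglongrightarrow> y"
  then show "\<exists>p w. (\<forall>n. poly_calc h (p n) (w n)) \<and>
      uniform_limit {-1..1} p (\<lambda>t. c * f t) sequentially \<and> w \<longlonglongrightarrow> c *\<^sub>R y"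
    by (intro exI[of _ "\<lambda>n t. c * fn n t"] exI[of _ "\<lambda>n. c *\<^sub>R yn n"] conjI allI)
      (simp_all add: poly_calc.scale tendsto_scaleR
        bounded_linear.uniform_limit[OF bounded_linear_mult_right])
qed

lemma fc_rel_norm_le:
  assumes "fc_rel f y" and M: "\<And>t. t \<in> {-1..1} \<Longrightarrow> \<bar>f t\<bar> \<le> M"
  shows "norm y \<le> M"
proof (rule field_le_epsilon)
  fix e :: real assume e: "0 < e"
  obtain g z where g: "\<And>n. poly_calc h (g n) (z n)" "uniform_limit {-1..1} g f sequentially"
    "z \<longlonglongrightarrow> y" using assms unfolding fc_rel_def by blast
  have "\<forall>\<^sub>F n in sequentially. norm (z n) \<le> M + e"
    using uniform_limitD[OF g(2) e]
  proof eventually_elim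
    case (elim n)
    have "\<bar>g n t\<bar> \<le> M + e" if "t \<in> {-1..1}" for t
      using elim that M[OF that] unfolding dist_real_def by force
    then show ?case using poly_calc_norm_le[OF sa norm_lt_1 g(1)] by blast
  qed
  then show "norm y \<le> M + e"
    by (rule tendsto_upperbound[OF tendsto_norm[OF g(3)]]) simp
qed

text \<open>The difference y - z represents the zero function, so the norm bound applies with M =
  0.\<close>

lemma fc_rel_unique: "fc_rel f y \<Longrightarrow> fc_rel f z \<Longrightarrow> y = z"
  using fc_rel_norm_le[OF fc_rel_add[OF _ fc_rel_scale[of f z "-1"]], of f y 0] by auto

text \<open>Subtracting \<open>p 0\<close> removes the constant term, which \<open>poly_calc\<close>
  does not generate. For products, f g - f(0) g(0) is expanded in the differences f - f(0) and g -
  g(0).\<close>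

lemma poly_calc_of_polynomial:
  assumes "real_polynomial_function p"
  shows "\<exists>y. poly_calc h (\<lambda>t. p t - p 0) y"
  using assms
proof (induction rule: real_polynomial_function.induct)
  case (linear f)
  then have "f t - f 0 = f 1 * t" for t
    using linear_simps(3)[OF linear] linear_simps(5)[OF linear, of t 1] by simp
  then show ?case using poly_calc.scale[OF poly_calc.ident, of h "f 1"] by auto
next
  case (const c)
  then show ?case using poly_calc.scale[OF poly_calc.ident, of h 0] by auto
next
  case (add f g)
  then obtain y z where "poly_calc h (\<lambda>t. f t - f 0) y" "poly_calc h (\<lambda>t. g t - g 0) z" by blast
  from poly_calc.add[OF this] show ?case by (auto simp: algebra_simps)
next
  case (mult f g)
  then obtain y z where yz: "poly_calc h (\<lambda>t. f t - f 0) y" "poly_calc h (\<lambda>t. g t - g 0) z" by blast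
  have "(\<lambda>t. f t * g t - f 0 * g 0) =
      (\<lambda>t. (f t - f 0) * (g t - g 0) + (g 0 * (f t - f 0) + f 0 * (g t - g 0)))"
    by (rule ext) (simp add: algebra_simps)
  then show ?case
    using poly_calc.add[OF poly_calc.mult[OF yz] poly_calc.add[OF poly_calc.scale[OF yz(1), of "g 0"]
        poly_calc.scale[OF yz(2), of "f 0"]]]
    by auto
qed

text \<open>Weierstrass approximation. As f vanishes at 0, dropping the constant term of the
  approximating polynomial at most doubles the error; the norm bound then makes the values a Cauchy
  sequence.\<close>

lemma fc_rel_exists:
  assumes "cont0 f"
  shows "\<exists>y. fc_rel f y"
proof -
  have "\<exists>g y. poly_calc h g y \<and> (\<forall>t\<in>{-1..1}. \<bar>f t - g t\<bar> < 2 * inverse (Suc n))" for n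
  proof -
    obtain p where p: "real_polynomial_function p" "\<And>t. t \<in> {-1..1} \<Longrightarrow> \<bar>f t - p t\<bar> < inverse (Suc n)"
      using assms Stone_Weierstrass_real_polynomial_function[of "{-1..1}" f "inverse (Suc n)"]
      by (auto simp: cont0_def)
    obtain y where "poly_calc h (\<lambda>t. p t - p 0) y" using poly_calc_of_polynomial[OF p(1)] by blast
    moreover have "\<bar>f t - (p t - p 0)\<bar> < 2 * inverse (Suc n)" if "t \<in> {-1..1}" for t
      using p(2)[OF that] p(2)[of 0] assms by (simp add: cont0_def)
    ultimately show ?thesis by blast
  qed
  then obtain g z where gz: "\<And>n. poly_calc h (g n) (z n)"
    "\<And>n t. t \<in> {-1..1} \<Longrightarrow> \<bar>f t - g n t\<bar> < 2 * inverse (Suc n)" by metis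
  have small: "\<exists>N. \<forall>n\<ge>N. 2 * inverse (real (Suc n)) < e" if "e > 0" for e
  proof -
    have "(\<lambda>n. 2 * inverse (real (Suc n))) \<longlonglongrightarrow> 0" by real_asymp
    from order_tendstoD(2)[OF this that] show ?thesis by (simp add: eventually_sequentially)
  qed
  have lim: "uniform_limit {-1..1} g f sequentially"
    unfolding uniform_limit_sequentially_iff
  proof (intro allI impI)
    fix e :: real assume "e > 0"
    then obtain N where N: "\<And>n. n \<ge> N \<Longrightarrow> 2 * inverse (real (Suc n)) < e" using small by blast
    show "\<exists>N. \<forall>n\<ge>N. \<forall>x\<in>{-1..1}. dist (g n x) (f x) < e"
    proof (intro exI[of _ N] allI impI ballI)
      fix n t assume "N \<le> n" "t \<in> {-1..1::real}"
      then show "dist (g n t) (f t) < e"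
        using gz(2)[of t n] N[of n] by (simp add: dist_real_def abs_minus_commute)
    qed
  qed
  have "Cauchy z"
  proof (rule metric_CauchyI)
    fix e :: real assume "e > 0"
    then obtain N where N: "\<And>n. n \<ge> N \<Longrightarrow> 2 * inverse (real (Suc n)) < e / 4"
      using small[of "e / 4"] by auto
    have "dist (z m) (z n) < e" if "m \<ge> N" "n \<ge> N" for m n
    proof -
      have "poly_calc h (\<lambda>t. g m t + (-1) * g n t) (z m + (-1) *\<^sub>R z n)"
        by (intro poly_calc.add poly_calc.scale gz)
      moreover have "\<bar>g m t + (-1) * g n t\<bar> \<le> e / 2" if "t \<in> {-1..1}" for t
        using gz(2)[OF that, of m] gz(2)[OF that, of n] N[OF \<open>m \<ge> N\<close>] N[OF \<open>n \<ge> N\<close>] by linarith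
      ultimately have "norm (z m + (-1) *\<^sub>R z n) \<le> e / 2"
        by (rule poly_calc_norm_le[OF sa norm_lt_1])
      then show ?thesis using \<open>e > 0\<close> by (simp add: dist_norm)
    qed
    then show "\<exists>M. \<forall>m\<ge>M. \<forall>n\<ge>M. dist (z m) (z n) < e" by blast
  qed
  then obtain y where "z \<longlonglongrightarrow> y" using Cauchy_convergent convergent_def by blast
  then show ?thesis
    using gz(1) lim unfolding fc_rel_def by (intro exI[of _ y] exI[of _ g] exI[of _ z] conjI allI)
qed

lemma fc_eqI: "fc_rel f y \<Longrightarrow> fc f = y"
  unfolding fc_def using fc_rel_unique by blast

lemma fc_rel_fc: "cont0 f \<Longrightarrow> fc_rel f (fc f)"
  using fc_rel_exists fc_eqI by blast

lemma fc_ident: "fc (\<lambda>t. t) = h"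
  by (intro fc_eqI poly_calc_imp_fc_rel poly_calc.ident)

lemma fc_add: "cont0 f \<Longrightarrow> cont0 g \<Longrightarrow> fc (\<lambda>t. f t + g t) = fc f + fc g"
  by (intro fc_eqI fc_rel_add fc_rel_fc)

lemma fc_scale: "cont0 f \<Longrightarrow> fc (\<lambda>t. c * f t) = c *\<^sub>R fc f"
  by (intro fc_eqI fc_rel_scale fc_rel_fc)

lemma fc_diff: "cont0 f \<Longrightarrow> cont0 g \<Longrightarrow> fc (\<lambda>t. f t - g t) = fc f - fc g"
  using fc_add[of f "\<lambda>t. (-1) * g t"] fc_scale[of g "-1"] cont0_intros(3)[of g "-1"] by simp

lemma fc_mult: "cont0 f \<Longrightarrow> cont0 g \<Longrightarrow> fc (\<lambda>t. f t * g t) = fc f * fc g"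
  by (intro fc_eqI fc_rel_mult fc_rel_fc)

lemma fc_norm_le: "cont0 f \<Longrightarrow> (\<And>t. t \<in> {-1..1} \<Longrightarrow> \<bar>f t\<bar> \<le> M) \<Longrightarrow> norm (fc f) \<le> M"
  by (rule fc_rel_norm_le[OF fc_rel_fc])

lemma fc_cong:
  assumes "cont0 f" "cont0 g" "\<And>t. t \<in> {-1..1} \<Longrightarrow> f t = g t"
  shows "fc f = fc g"
  using fc_norm_le[of "\<lambda>t. f t - g t" 0] assms by (auto simp: fc_diff)

lemma fc_0: "fc (\<lambda>t. 0) = 0"
  using fc_norm_le[of "\<lambda>t. 0" 0] by auto

lemma fc_sum:
  "finite I \<Longrightarrow> (\<And>i. i \<in> I \<Longrightarrow> cont0 (f i)) \<Longrightarrow> fc (\<lambda>t. \<Sum>i\<in>I. f i t) = (\<Sum>i\<in>I. fc (f i))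
     \<and> cont0 (\<lambda>t. \<Sum>i\<in>I. f i t)"
  by (induction I rule: finite_induct) (auto simp: fc_0 fc_add)

lemma fc_selfadjoint:
  assumes "cont0 f"
  shows "cstar (fc f) = fc f"
proof -
  obtain g z where gz: "\<And>n. poly_calc h (g n) (z n)" "z \<longlonglongrightarrow> fc f"
    using fc_rel_fc[OF assms] unfolding fc_rel_def by blast
  have "z \<longlonglongrightarrow> cstar (fc f)"
    using tendsto_cstar[OF gz(2)] by (simp add: poly_calc_selfadjoint[OF gz(1) sa])
  then show ?thesis using gz(2) by (rule LIMSEQ_unique)
qed

text \<open>The second function vanishes for \<bar>t\<bar> \<le> \<delta>, the first is 1 wherever
  the second is nonzero, and the third, the identity minus the second, is bounded by
  \<delta>.\<close>

lemma cont0_cutoff: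
  assumes "0 < \<delta>"
  shows "cont0 (\<lambda>t. min 1 (\<bar>t\<bar> / \<delta>))" "cont0 (\<lambda>t. t - max (-\<delta>) (min \<delta> t))"
    "cont0 (\<lambda>t. max (-\<delta>) (min \<delta> t))"
  using assms by (auto simp: cont0_def intro!: continuous_intros)

text \<open>g is h with its small spectral values cut to 0, and e is a cutoff equal to 1 on the
  support of the truncating function.\<close>

lemma local_unit:
  assumes "0 < \<delta>"
  obtains e g where "e * g = g" "g * e = g" "norm (h - g) \<le> \<delta>"
proof -
  let ?f = "\<lambda>t. min 1 (\<bar>t\<bar> / \<delta>)" and ?g = "\<lambda>t. t - max (-\<delta>) (min \<delta> t)"
  note c = cont0_cutoff[OF assms]
  have fg: "?f t * ?g t = ?g t" for t
    using assms by (auto simp: min_def max_def field_simps)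
  have "(\<lambda>t. ?f t * ?g t) = ?g" by (rule ext) (rule fg)
  moreover have "(\<lambda>t. ?g t * ?f t) = ?g" by (rule ext) (metis fg mult.commute)
  ultimately have "fc ?f * fc ?g = fc ?g" "fc ?g * fc ?f = fc ?g"
    unfolding fc_mult[OF c(1,2), symmetric] fc_mult[OF c(2,1), symmetric] by (simp_all only:)
  moreover have "norm (fc (\<lambda>t. t) - fc ?g) \<le> \<delta>"
    unfolding fc_diff[OF cont0_intros(1) c(2), symmetric]
    using assms c(3) by (intro fc_norm_le) auto
  ultimately show ?thesis using that fc_ident by metis
qed

end

section \<open>Ideals and commutators in rings\<close>

definition add_subgroup :: "'a::ab_group_add set \<Rightarrow> bool" where
  "add_subgroup G \<longleftrightarrow> 0 \<in> G \<and> (\<forall>x\<in>G. \<forall>y\<in>G. x - y \<in> G)"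

lemma add_subgroupD:
  assumes "add_subgroup G"
  shows "0 \<in> G" "x \<in> G \<Longrightarrow> y \<in> G \<Longrightarrow> x - y \<in> G" "x \<in> G \<Longrightarrow> - x \<in> G"
    "x \<in> G \<Longrightarrow> y \<in> G \<Longrightarrow> x + y \<in> G"
proof -
  show 0: "0 \<in> G" and d: "x \<in> G \<Longrightarrow> y \<in> G \<Longrightarrow> x - y \<in> G" for x y
    using assms by (auto simp: add_subgroup_def)
  show m: "x \<in> G \<Longrightarrow> - x \<in> G" for x using d[OF 0, of x] by simp
  show "x \<in> G \<Longrightarrow> y \<in> G \<Longrightarrow> x + y \<in> G" using d[OF _ m, of x y] by simp
qed

lemma add_gen_base: "x \<in> S \<Longrightarrow> x \<in> add_gen S"
  unfolding add_gen_def by (auto intro!: exI[of _ "[x]"])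

lemma add_subgroup_add_gen: "add_subgroup (add_gen S)"
  unfolding add_subgroup_def
proof (intro conjI ballI)
  show "0 \<in> add_gen S" unfolding add_gen_def by (auto intro!: exI[of _ "[]"])
  fix x y assume "x \<in> add_gen S" "y \<in> add_gen S"
  then obtain xs ys where *: "set xs \<subseteq> S \<union> uminus ` S" "x = sum_list xs"
    "set ys \<subseteq> S \<union> uminus ` S" "y = sum_list ys" unfolding add_gen_def by blast
  have "sum_list (map uminus ys) = - sum_list ys" by (induction ys) auto
  then have "x - y = sum_list (xs @ map uminus ys)" using * by simp
  moreover have "set (xs @ map uminus ys) \<subseteq> S \<union> uminus ` S" using * by force
  ultimately show "x - y \<in> add_gen S" unfolding add_gen_def by blast
qed

lemma add_gen_least:
  assumes "S \<subseteq> G" "add_subgroup G"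
  shows "add_gen S \<subseteq> G"
proof
  fix x assume "x \<in> add_gen S"
  then obtain xs where xs: "set xs \<subseteq> S \<union> uminus ` S" "x = sum_list xs"
    unfolding add_gen_def by blast
  have "sum_list xs \<in> G" using xs(1)
    by (induction xs) (use assms add_subgroupD[OF assms(2)] in auto)
  then show "x \<in> G" using xs by simp
qed

lemma add_subgroup_prod_set [simp]: "add_subgroup (prod_set X Y)"
  and add_subgroup_comm_set [simp]: "add_subgroup (comm_set X Y)"
  by (simp_all add: prod_set_def comm_set_def add_subgroup_add_gen)

lemma prod_set_base: "x \<in> X \<Longrightarrow> y \<in> Y \<Longrightarrow> x * y \<in> prod_set X Y"
  unfolding prod_set_def by (auto intro: add_gen_base)

lemma comm_set_base: "x \<in> X \<Longrightarrow> y \<in> Y \<Longrightarrow> commutator x y \<in> comm_set X Y"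
  unfolding comm_set_def by (auto intro: add_gen_base)

lemma prod_set_least:
  "(\<And>x y. x \<in> X \<Longrightarrow> y \<in> Y \<Longrightarrow> x * y \<in> G) \<Longrightarrow> add_subgroup G \<Longrightarrow> prod_set X Y \<subseteq> G"
  unfolding prod_set_def by (rule add_gen_least) auto

lemma comm_set_least:
  "(\<And>x y. x \<in> X \<Longrightarrow> y \<in> Y \<Longrightarrow> commutator x y \<in> G) \<Longrightarrow> add_subgroup G \<Longrightarrow> comm_set X Y \<subseteq> G"
  unfolding comm_set_def by (rule add_gen_least) auto

abbreviation triple_prod :: "'a::ring set \<Rightarrow> 'a set" where
  "triple_prod X \<equiv> prod_set (prod_set UNIV X) UNIV"

abbreviation commutators :: "'a::ring set" where
  "commutators \<equiv> comm_set UNIV UNIV"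

lemma triple_prod_base: "x \<in> X \<Longrightarrow> a * x * b \<in> triple_prod X"
  by (simp add: prod_set_base)

lemma triple_prod_least:
  assumes "\<And>a x b. x \<in> X \<Longrightarrow> a * x * b \<in> G" "add_subgroup G"
  shows "triple_prod X \<subseteq> G"
proof (rule prod_set_least)
  fix p b assume p: "p \<in> prod_set UNIV X"
  have "prod_set UNIV X \<subseteq> {p. \<forall>b. p * b \<in> G}"
    using assms by (intro prod_set_least) (auto simp: add_subgroup_def left_diff_distrib)
  then show "p * b \<in> G" using p by blast
qed fact

section \<open>Two-sided ideals, maximality and primeness\<close>

definition two_sided_ideal :: "'a::ring set \<Rightarrow> bool" where
  "two_sided_ideal I \<longleftrightarrow> add_subgroup I \<and> (\<forall>x\<in>I. \<forall>r. r * x \<in> I \<and> x * r \<in> I)"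

lemma two_sided_idealD:
  assumes "two_sided_ideal I"
  shows "add_subgroup I" "x \<in> I \<Longrightarrow> r * x \<in> I" "x \<in> I \<Longrightarrow> x * r \<in> I"
  using assms by (auto simp: two_sided_ideal_def)

lemma two_sided_ideal_triple_prod: "two_sided_ideal (triple_prod X)"
  unfolding two_sided_ideal_def
proof (intro conjI ballI allI)
  fix x r assume "x \<in> triple_prod X"
  moreover have "triple_prod X \<subseteq> {x. r * x \<in> triple_prod X}"
    using triple_prod_base[of _ X "r * _"] add_subgroupD[OF add_subgroup_prod_set]
    by (intro triple_prod_least) (auto simp: add_subgroup_def right_diff_distrib mult.assoc)
  moreover have "triple_prod X \<subseteq> {x. x * r \<in> triple_prod X}"
    using triple_prod_base[of _ X _ "_ * r"] add_subgroupD[OF add_subgroup_prod_set]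
    by (intro triple_prod_least) (auto simp: add_subgroup_def left_diff_distrib mult.assoc)
  ultimately show "r * x \<in> triple_prod X" "x * r \<in> triple_prod X" by auto
qed simp

lemma two_sided_idealI:
  assumes "0 \<in> I" "\<And>x y. x \<in> I \<Longrightarrow> y \<in> I \<Longrightarrow> x - y \<in> I"
    "\<And>x r. x \<in> I \<Longrightarrow> r * x \<in> I" "\<And>x r. x \<in> I \<Longrightarrow> x * r \<in> I"
  shows "two_sided_ideal I"
  using assms by (simp add: two_sided_ideal_def add_subgroup_def)

text \<open>The first ideal enlarges I to all elements that I absorbs after multiplication on both
  sides; the other two are the annihilator-type ideals behind the proof of primeness.\<close>

lemma two_sided_ideal_transporter:
  assumes "two_sided_ideal I"
  shows "two_sided_ideal {y. \<forall>b d. b * y * d \<in> I}"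
    "two_sided_ideal {y. \<forall>r. y * r * b \<in> I}"
    "two_sided_ideal {y. \<forall>r. a * r * y \<in> I}"
proof -
  note D = two_sided_idealD[OF assms] add_subgroupD[OF two_sided_idealD(1)[OF assms]]
  show "two_sided_ideal {y. \<forall>b d. b * y * d \<in> I}"
  proof (rule two_sided_idealI; clarsimp simp: D left_diff_distrib right_diff_distrib)
    fix x r b d assume *: "\<forall>b d. b * x * d \<in> I"
    show "b * (r * x) * d \<in> I" using *[rule_format, of "b * r" d] by (simp add: mult.assoc)
    show "b * (x * r) * d \<in> I" using *[rule_format, of b "r * d"] by (simp add: mult.assoc)
  qed
  show "two_sided_ideal {y. \<forall>r. y * r * b \<in> I}"
  proof (rule two_sided_idealI; clarsimp simp: D left_diff_distrib right_diff_distrib)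
    fix x r s assume *: "\<forall>r. x * r * b \<in> I"
    show "r * x * s * b \<in> I" using D(2)[OF *[rule_format, of s], of r] by (simp add: mult.assoc)
    show "x * r * s * b \<in> I" using *[rule_format, of "r * s"] by (simp add: mult.assoc)
  qed
  show "two_sided_ideal {y. \<forall>r. a * r * y \<in> I}"
  proof (rule two_sided_idealI; clarsimp simp: D left_diff_distrib right_diff_distrib)
    fix x r s assume *: "\<forall>r. a * r * x \<in> I"
    show "a * s * (r * x) \<in> I" using *[rule_format, of "s * r"] by (simp add: mult.assoc)
    show "a * s * (x * r) \<in> I" using D(3)[OF *[rule_format, of s], of r] by (simp add: mult.assoc)
  qed
qed

text \<open>Zorn's lemma: the union of a nonempty chain of ideals missing S is again an ideal
  missing S.\<close>

lemma exists_maximal_ideal_avoiding: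
  assumes "two_sided_ideal I" "I \<inter> S = {}"
  obtains M where "two_sided_ideal M" "I \<subseteq> M" "M \<inter> S = {}"
    "\<And>N. two_sided_ideal N \<Longrightarrow> M \<subseteq> N \<Longrightarrow> N \<inter> S = {} \<Longrightarrow> N = M"
proof -
  define \<A> where "\<A> = {M. two_sided_ideal M \<and> I \<subseteq> M \<and> M \<inter> S = {}}"
  have "\<exists>M\<in>\<A>. \<forall>X\<in>\<A>. M \<subseteq> X \<longrightarrow> X = M"
  proof (rule subset_Zorn_nonempty)
    show "\<A> \<noteq> {}" using assms by (auto simp: \<A>_def)
    fix \<C> assume C: "\<C> \<noteq> {}" "subset.chain \<A> \<C>"
    then have sub: "\<C> \<subseteq> \<A>" and chain: "\<And>X Y. X \<in> \<C> \<Longrightarrow> Y \<in> \<C> \<Longrightarrow> X \<subseteq> Y \<or> Y \<subseteq> X"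
      by (auto simp: subset_chain_def)
    have ideal: "two_sided_ideal X" if "X \<in> \<C>" for X using that sub by (auto simp: \<A>_def)
    have "two_sided_ideal (\<Union>\<C>)"
      unfolding two_sided_ideal_def add_subgroup_def
    proof (intro conjI ballI allI)
      show "0 \<in> \<Union>\<C>"
        using C(1) add_subgroupD(1)[OF two_sided_idealD(1)[OF ideal]] by blast
      fix x assume "x \<in> \<Union>\<C>"
      then obtain X where X: "x \<in> X" "X \<in> \<C>" by blast
      show "r * x \<in> \<Union>\<C>" "x * r \<in> \<Union>\<C>" for r
        using two_sided_idealD(2,3)[OF ideal] X by blast+
      fix y assume "y \<in> \<Union>\<C>"
      then obtain Y where Y: "y \<in> Y" "Y \<in> \<C>" by blast
      obtain Z where "Z \<in> \<C>" "x \<in> Z" "y \<in> Z" using chain X Y by blast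
      then show "x - y \<in> \<Union>\<C>"
        using add_subgroupD(2)[OF two_sided_idealD(1)[OF ideal]] by blast
    qed
    then show "\<Union>\<C> \<in> \<A>" using C(1) sub unfolding \<A>_def by blast
  qed
  then obtain M where M: "M \<in> \<A>" "\<And>X. X \<in> \<A> \<Longrightarrow> M \<subseteq> X \<Longrightarrow> X = M" by blast
  show ?thesis
  proof (rule that)
    fix N assume "two_sided_ideal N" "M \<subseteq> N" "N \<inter> S = {}"
    moreover have "I \<subseteq> N" using M(1) \<open>M \<subseteq> N\<close> by (auto simp: \<A>_def)
    ultimately show "N = M" by (intro M(2)) (simp_all add: \<A>_def)
  qed (use M(1) in \<open>auto simp: \<A>_def\<close>)
qed

text \<open>Primeness for a noncommutative ring, tested on a R b instead of the single product a b.
  The whole ring qualifies too; properness is recorded separately by elements that P avoids.\<close>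

definition prime_ideal :: "'a::ring set \<Rightarrow> bool" where
  "prime_ideal P \<longleftrightarrow> two_sided_ideal P \<and> (\<forall>a b. (\<forall>r. a * r * b \<in> P) \<longrightarrow> a \<in> P \<or> b \<in> P)"

text \<open>\<open>x n\<close> behaves like the power with exponent n + 1 of one element. An ideal
  maximal among those avoiding all of them is prime: if a R b lies in P but neither a nor b does,
  the two transporter ideals strictly enlarge P, so each contains some member of the family.\<close>

lemma exists_prime_ideal_avoiding_powers:
  fixes x :: "nat \<Rightarrow> 'a::ring"
  assumes I: "two_sided_ideal I" "\<And>n. x n \<notin> I" and pow: "\<And>m n. x m * x n = x (Suc (m + n))"
  obtains P where "prime_ideal P" "I \<subseteq> P" "\<And>n. x n \<notin> P"
proof -
  have "I \<inter> range x = {}" using I by auto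
  then obtain P where
    P: "two_sided_ideal P" "I \<subseteq> P" "P \<inter> range x = {}"
    and max: "\<And>N. two_sided_ideal N \<Longrightarrow> P \<subseteq> N \<Longrightarrow> N \<inter> range x = {} \<Longrightarrow> N = P"
    by (rule exists_maximal_ideal_avoiding[OF I(1)]) (rule that)
  note D = two_sided_idealD[OF P(1)] add_subgroupD[OF two_sided_idealD(1)[OF P(1)]]
  have "a \<in> P \<or> b \<in> P" if ab: "\<And>r. a * r * b \<in> P" for a b
  proof (rule ccontr)
    assume *: "\<not> (a \<in> P \<or> b \<in> P)"
    let ?N = "{y. \<forall>r. y * r * b \<in> P}"
    have "two_sided_ideal ?N" by (rule two_sided_ideal_transporter(2)[OF P(1)])
    moreover have "P \<subseteq> ?N" by (auto intro: D(3))
    moreover have "?N \<noteq> P" using * ab by blast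
    ultimately have "?N \<inter> range x \<noteq> {}" using max by metis
    then obtain m where m: "\<And>r. x m * r * b \<in> P" by blast
    let ?N' = "{y. \<forall>r. x m * r * y \<in> P}"
    have "two_sided_ideal ?N'" by (rule two_sided_ideal_transporter(3)[OF P(1)])
    moreover have "P \<subseteq> ?N'" by (auto intro: D(2))
    moreover have "?N' \<noteq> P" using * m by blast
    ultimately have "?N' \<inter> range x \<noteq> {}" using max by metis
    then obtain n where "\<And>r. x m * r * x n \<in> P" by blast
    \<comment> \<open>With \<open>x 0\<close> in the middle, the product of the three is again a
      member of the family, yet it lies in P.\<close>
    from this[of "x 0"] P(3) show False by (auto simp: pow)
  qed
  then have "prime_ideal P" using P(1) by (simp add: prime_ideal_def)
  then show ?thesis using P(2,3) by (intro that[of P]) auto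
qed

text \<open>If ad a squares to zero modulo a prime ideal, then \<open>2 [a,x] [a,y]\<close> vanishes by the Leibniz rule,
  and hence so does \<open>[a,x] y [a,x]\<close>. Halving elements removes the factor 2.\<close>
lemma prime_ideal_ad_square_zero:
  fixes a :: "'a::real_algebra"
  assumes prime: "prime_ideal P"
    and sq: "\<And>x. commutator a (commutator a x) \<in> P"
  shows "commutator a x \<in> P"
proof -
  have P: "two_sided_ideal P" using prime by (simp add: prime_ideal_def)
  note D = two_sided_idealD[OF P] add_subgroupD[OF two_sided_idealD(1)[OF P]]
  let ?d = "commutator a"
  have prod: "?d x * ?d y \<in> P" for x y
  proof -
    let ?x = "(1/2) *\<^sub>R x"
    have "2 *\<^sub>R (?d ?x * ?d y) = ?d (?d (?x * y)) - ?d (?d ?x) * y - ?x * ?d (?d y)"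
      by (simp only: scaleR_2) (simp add: commutator_def algebra_simps)
    moreover have "2 *\<^sub>R (?d ?x * ?d y) = ?d x * ?d y"
      by (simp add: commutator_def algebra_simps)
    ultimately show ?thesis using D sq by metis
  qed
  have "?d x * y * ?d x \<in> P" for y
  proof -
    have "?d x * y * ?d x = ?d x * ?d (y * x) - (?d x * ?d y) * x"
      by (simp add: commutator_def algebra_simps)
    then show ?thesis using D prod by metis
  qed
  then show ?thesis using prime unfolding prime_ideal_def by blast
qed

lemma commutator_in_commutators: "commutator x y \<in> commutators"
  by (simp add: comm_set_base)

text \<open>Writing L for the commutators, \<open>[u,v] a = [u,va] - v [u,a]\<close> shows that the ideal of \<open>[L,L]\<close>
  lies in L + LL, and L + LL = A in turn forces L to lie in LL.\<close>
lemma prod_commutators_eq_UNIV: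
  assumes "triple_prod (comm_set commutators commutators) = (UNIV :: 'a::ring set)"
  shows "prod_set commutators commutators = (UNIV :: 'a set)"
proof -
  let ?L = "commutators :: 'a set"
  let ?P = "prod_set ?L ?L" and ?LL = "comm_set ?L ?L"
  define K where "K = {u + v | u v. u \<in> ?L \<and> v \<in> ?P}"
  note L = add_subgroupD[OF add_subgroup_comm_set[of UNIV UNIV]]
    and P = add_subgroupD[OF add_subgroup_prod_set[of ?L ?L]]
    and LL = add_subgroupD[OF add_subgroup_comm_set[of ?L ?L]]
  have K: "add_subgroup K"
    unfolding add_subgroup_def
  proof (intro conjI ballI)
    show "0 \<in> K" unfolding K_def using L(1) P(1) by force
    fix x y assume "x \<in> K" "y \<in> K"
    then obtain u v u' v' where *: "u \<in> ?L" "v \<in> ?P" "u' \<in> ?L" "v' \<in> ?P" "x = u + v" "y = u' + v'"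
      unfolding K_def by blast
    then have "x - y = (u - u') + (v - v')" by simp
    then show "x - y \<in> K" unfolding K_def using * L(2) P(2) by blast
  qed
  have right: "c * a \<in> K" if "c \<in> ?LL" for c a
  proof -
    have "?LL \<subseteq> {c. \<forall>a. c * a \<in> K}"
    proof (rule comm_set_least)
      fix u v assume uv: "u \<in> ?L" "v \<in> ?L"
      have "commutator u v * a = commutator u (v * a) + - (v * commutator u a)" for a
        by (simp add: commutator_def algebra_simps)
      moreover have "- (v * commutator u a) \<in> ?P" for a
        using uv by (intro P prod_set_base commutator_in_commutators)
      ultimately show "commutator u v \<in> {c. \<forall>a. c * a \<in> K}"
        unfolding K_def using commutator_in_commutators by blast
    qed (use K in \<open>auto simp: add_subgroup_def left_diff_distrib\<close>)
    then show ?thesis using that by blast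
  qed
  have ad: "commutator b c \<in> ?LL" if "c \<in> ?LL" for b c
  proof -
    have "?LL \<subseteq> {c. commutator b c \<in> ?LL}"
    proof (rule comm_set_least)
      fix u v assume uv: "u \<in> ?L" "v \<in> ?L"
      have "commutator b (commutator u v) =
          commutator (commutator b u) v + commutator u (commutator b v)"
        by (simp add: commutator_def algebra_simps)
      moreover have "commutator (commutator b u) v \<in> ?LL" "commutator u (commutator b v) \<in> ?LL"
        using uv by (auto intro: comm_set_base commutator_in_commutators)
      ultimately show "commutator u v \<in> {c. commutator b c \<in> ?LL}" using LL(4) by auto
    next
      have "commutator b (x - y) = commutator b x - commutator b y" for x y
        by (simp add: commutator_def algebra_simps)
      then show "add_subgroup {c. commutator b c \<in> ?LL}"
        using LL by (auto simp: add_subgroup_def) (simp add: commutator_def)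
    qed
    then show ?thesis using that by blast
  qed
  have "triple_prod ?LL \<subseteq> K"
  proof (rule triple_prod_least)
    fix b c a assume c: "c \<in> ?LL"
    \<comment> \<open>The left factor b is moved across c; the commutator this costs stays in
      \<open>?LL\<close> by \<open>ad\<close>, so \<open>right\<close> handles both terms.\<close>
    have "b * c * a = commutator b c * a + c * (b * a)"
      by (simp add: commutator_def algebra_simps)
    then show "b * c * a \<in> K" using right[OF ad[OF c]] right[OF c] add_subgroupD(4)[OF K] by metis
  qed (rule K)
  then have KU: "K = UNIV" using assms by auto
  have adP: "commutator a p \<in> ?P" if "p \<in> ?P" for a p
  proof -
    have "?P \<subseteq> {p. commutator a p \<in> ?P}"
    proof (rule prod_set_least)
      fix u v assume uv: "u \<in> ?L" "v \<in> ?L"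
      have "commutator a (u * v) = commutator a u * v + u * commutator a v"
        by (simp add: commutator_def algebra_simps)
      moreover have "commutator a u * v \<in> ?P" "u * commutator a v \<in> ?P"
        using uv by (auto intro: prod_set_base commutator_in_commutators)
      ultimately show "u * v \<in> {p. commutator a p \<in> ?P}" using P(4) by auto
    next
      have "commutator a (x - y) = commutator a x - commutator a y" for x y
        by (simp add: commutator_def algebra_simps)
      then show "add_subgroup {p. commutator a p \<in> ?P}"
        using P by (auto simp: add_subgroup_def) (simp add: commutator_def)
    qed
    then show ?thesis using that by blast
  qed
  have "?L \<subseteq> ?P"
  proof (rule comm_set_least)
    fix x y :: 'a
    obtain u v u' v' where *: "u \<in> ?L" "v \<in> ?P" "u' \<in> ?L" "v' \<in> ?P" "x = u + v" "y = u' + v'"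
      using KU unfolding K_def by blast
    \<comment> \<open>Expanding with x = u + v and y = u' + v' leaves products of commutators, and
      commutators with v or v', which stay in \<open>?P\<close> by \<open>adP\<close>.\<close>
    have "commutator x y = commutator x v' + ((u * u' - u' * u) - commutator u' v)"
      using * by (simp add: commutator_def algebra_simps)
    then show "commutator x y \<in> ?P"
      using * by (auto intro!: P adP prod_set_base)
  qed simp
  then have "K \<subseteq> ?P" unfolding K_def using P(4) by blast
  then show ?thesis using KU by auto
qed

section \<open>Factorization and the algebraic equivalences\<close>

text \<open>g tends to 0 at 0 more slowly than any power of \<bar>t\<bar>, so t divided by any power
  of g still extends continuously by 0. Hence every power of the single element g(h) divides
  h.\<close>

lemma (in sa_contraction) log_factorization:
  obtains x y where "\<And>m n. x m * x n = x (Suc (m + n))" "\<And>n::nat. h = x n * y n"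
proof -
  \<comment> \<open>As \<open>ln 0 = 0\<close>, the formula alone would give 1 at t = 0, hence the
    case distinction. In \<open>q\<close> the factor t already forces the value 0.\<close>
  define g :: "real \<Rightarrow> real" where "g t = (if t = 0 then 0 else 1 / (1 - ln \<bar>t\<bar>))" for t
  define q :: "nat \<Rightarrow> real \<Rightarrow> real" where "q n t = t * (1 - ln \<bar>t\<bar>) ^ Suc n" for n t
  have pos: "1 - ln \<bar>t\<bar> > 0" if "t \<in> {-1..1}" "t \<noteq> 0" for t :: real
  proof -
    have "ln \<bar>t\<bar> \<le> ln 1" using that by (subst ln_le_cancel_iff) auto
    then show ?thesis by simp
  qed
  have "continuous_on {-1..1} g"
    unfolding continuous_on_eq_continuous_within
  proof
    fix t :: real assume t: "t \<in> {-1..1}"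
    show "continuous (at t within {-1..1}) g"
    proof (cases "t = 0")
      case True
      have "((\<lambda>t. 1 / (1 - ln \<bar>t\<bar>)) \<longlongrightarrow> 0) (at (0::real))" by real_asymp
      then have "(g \<longlongrightarrow> 0) (at 0)"
        by (rule Lim_transform_eventually) (auto simp: g_def eventually_at_filter)
      then show ?thesis
        by (simp add: True continuous_within g_def) (metis Lim_at_imp_Lim_at_within)
    next
      case False
      have "isCont (\<lambda>t. 1 / (1 - ln \<bar>t\<bar>)) t"
        using False pos[OF t False] by (intro continuous_intros) auto
      moreover have "eventually (\<lambda>s. s \<noteq> 0) (nhds t)" using False by (rule t1_space_nhds)
      then have "eventually (\<lambda>s. 1 / (1 - ln \<bar>s\<bar>) = g s) (nhds t)"
        by eventually_elim (simp add: g_def)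
      then have "isCont (\<lambda>t. 1 / (1 - ln \<bar>t\<bar>)) t \<longleftrightarrow> isCont g t" by (rule isCont_cong)
      ultimately have "isCont g t" by blast
      then show ?thesis by (rule continuous_at_imp_continuous_at_within)
    qed
  qed
  then have g: "cont0 (\<lambda>t. g t ^ Suc n)" for n
    by (auto simp: cont0_def g_def intro!: continuous_intros)
  have q: "cont0 (q n)" for n
  proof -
    have "isCont (q n) t" for t
    proof (cases "t = 0")
      case True
      have "((\<lambda>t. t * (1 - ln \<bar>t\<bar>) ^ Suc n) \<longlongrightarrow> 0) (at (0::real))" by real_asymp
      then show ?thesis unfolding True isCont_def q_def by (simp only: mult_zero_left)
    next
      case False
      then show ?thesis unfolding q_def by (intro continuous_intros) auto
    qed
    then show ?thesis
      by (simp add: cont0_def continuous_at_imp_continuous_on) (simp add: q_def)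
  qed
  show ?thesis
  proof (rule that)
    fix m n
    show "fc (\<lambda>t. g t ^ Suc m) * fc (\<lambda>t. g t ^ Suc n) = fc (\<lambda>t. g t ^ Suc (Suc (m + n)))"
      unfolding fc_mult[OF g g, symmetric] by (simp add: power_add algebra_simps)
    have "fc (\<lambda>t. t) = fc (\<lambda>t. g t ^ Suc n * q n t)"
    proof (rule fc_cong)
      fix t :: real assume t: "t \<in> {-1..1}"
      have "g t ^ Suc n * q n t = t * (g t * (1 - ln \<bar>t\<bar>)) ^ Suc n"
        by (simp add: q_def power_mult_distrib)
      also have "\<dots> = t" using pos[OF t] by (cases "t = 0") (auto simp: g_def)
      finally show "t = g t ^ Suc n * q n t" ..
    qed (use g q in auto)
    then show "h = fc (\<lambda>t. g t ^ Suc n) * fc (q n)"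
      by (simp only: fc_ident fc_mult[OF g q])
  qed
qed

text \<open>Real and imaginary parts, scaled by r so that both have norm less than 1; the common
  factor c = 1 / (2 r) undoes the scaling.\<close>

lemma sa_decomposition:
  fixes a :: "'a::cstar_algebra"
  obtains c h k where "sa_contraction h" "sa_contraction k" "a = cscale c h + cscale (c * \<i>) k"
proof -
  define r where "r = 1 / (2 * (norm a + 1))"
  have n: "norm a + 1 > 0" using norm_ge_zero[of a] by linarith
  have r: "r > 0" "2 * r * norm a < 1" using n by (auto simp: r_def field_simps)
  define h where "h = r *\<^sub>R (a + cstar a)"
  define k where "k = cscale (- \<i>) (r *\<^sub>R (a - cstar a))"
  have "norm (a + cstar a) \<le> 2 * norm a" "norm (a - cstar a) \<le> 2 * norm a"
    using norm_triangle_ineq[of a "cstar a"] norm_triangle_ineq4[of a "cstar a"] by auto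
  moreover have "r * x < 1" if "x \<le> 2 * norm a" for x
  proof -
    have "r * x \<le> r * (2 * norm a)" using that r by (intro mult_left_mono) auto
    also have "\<dots> < 1" using r by (simp add: ac_simps)
    finally show ?thesis .
  qed
  ultimately have "norm h < 1" "norm k < 1"
    using r by (auto simp: h_def k_def norm_cscale)
  moreover have "cstar h = h" by (simp add: h_def cstar_scaleR cstar_add cstar_cstar add.commute)
  moreover have "cstar k = k"
    by (simp add: k_def cstar_cscale cstar_scaleR cstar_diff cstar_cstar cscale_linear scaleR_diff_right)
  moreover have "cscale (complex_of_real (1 / (2 * r))) h + cscale (complex_of_real (1 / (2 * r)) * \<i>) k = a"
  proof -
    have "cscale (complex_of_real (1 / (2 * r))) h + cscale (complex_of_real (1 / (2 * r)) * \<i>) k =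
      cscale (complex_of_real (1 / (2 * r))) (h + cscale \<i> k)"
      by (simp add: cscale_linear cscale_cscale)
    also have "h + cscale \<i> k = (2 * r) *\<^sub>R a"
      by (simp add: h_def k_def cscale_cscale cscale_one algebra_simps)
        (simp flip: scaleR_add_left)
    also have "cscale (complex_of_real (1 / (2 * r))) \<dots> = a"
      using r by (simp only: cscale_of_real) simp
    finally show ?thesis .
  qed
  ultimately show ?thesis by (intro that[of h k "complex_of_real (1 / (2 * r))"]) (auto simp: sa_contraction_def)
qed

text \<open>If I met every such family, the logarithmic factorization would put all selfadjoint
  contractions and their complex multiples into I, and these span the algebra.\<close>

lemma proper_ideal_avoids_powers:
  fixes I :: "'a::cstar_algebra set"
  assumes I: "two_sided_ideal I" "I \<noteq> UNIV"
  obtains x where "\<And>m n. x m * x n = x (Suc (m + n))" "\<And>n. x n \<notin> I"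
proof (rule ccontr)
  assume no: "\<not> thesis"
  note avoids = that
  have ex: "\<exists>n. x n \<in> I" if "\<And>m n. x m * x n = x (Suc (m + n))" for x
    using no avoids[OF that] by blast
  have h: "cscale c h \<in> I" if "sa_contraction h" for c h
  proof -
    obtain x y where xy: "\<And>m n. x m * x n = x (Suc (m + n))" "\<And>n::nat. h = x n * y n"
      by (rule sa_contraction.log_factorization[OF \<open>sa_contraction h\<close>]) (rule that)
    obtain n where "x n \<in> I" using ex[OF xy(1)] by blast
    \<comment> \<open>The scalar goes into the second factor, since I is only a ring ideal and not
      assumed to be a complex subspace.\<close>
    then have "x n * cscale c (y n) \<in> I" using I two_sided_idealD(3) by blast
    then show ?thesis using xy(2)[of n] by (simp add: cscale_mult_right)
  qed
  have "a \<in> I" for a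
  proof -
    obtain c h k where "sa_contraction h" "sa_contraction k" "a = cscale c h + cscale (c * \<i>) k"
      by (rule sa_decomposition)
    then show ?thesis using h add_subgroupD(4)[OF two_sided_idealD(1)[OF I(1)]] by simp
  qed
  then show False using I by blast
qed

text \<open>A proper ideal would avoid a family of powers, but \<open>x 0 * x 0 * x 0 = x 2\<close>
  has the form b y d. In effect, the algebra equals its own threefold product.\<close>

lemma ideal_eq_UNIV_of_transporter:
  fixes I :: "'a::cstar_algebra set"
  assumes "two_sided_ideal I" "\<And>b y d. b * y * d \<in> I"
  shows "I = UNIV"
proof (rule ccontr)
  assume "I \<noteq> UNIV"
  then obtain x where "\<And>m n. x m * x n = x (Suc (m + n))" "\<And>n::nat. x n \<notin> I"
    by (rule proper_ideal_avoids_powers[OF assms(1)]) (rule that)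
  then show False using assms(2)[of "x 0" "x 0" "x 0"] by simp
qed

section \<open>The implications between the algebraic conditions\<close>

lemma add_subgroup_sandwich: "add_subgroup (unitization_sandwich X)"
  by (simp add: unitization_sandwich_def add_subgroup_add_gen)

lemma sandwich_least:
  assumes "\<And>l m a b x. x \<in> X \<Longrightarrow> cscale l (cscale m x) + cscale l (x * b) + cscale m (a * x) + a * x * b \<in> G"
    and "add_subgroup G"
  shows "unitization_sandwich X \<subseteq> G"
  unfolding unitization_sandwich_def using assms by (intro add_gen_least) auto

text \<open>Multiplying on both sides by elements of the algebra absorbs the unitization: p (l + a)
  and (m + b) q lie in the algebra itself.\<close>

lemma triple_prod_eq_UNIV_of_sandwich:
  fixes X :: "'a::cstar_algebra set"
  assumes "unitization_sandwich X = UNIV"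
  shows "triple_prod X = UNIV"
proof (rule ideal_eq_UNIV_of_transporter[OF two_sided_ideal_triple_prod])
  fix b y d :: 'a
  let ?T = "{y. \<forall>b d. b * y * d \<in> triple_prod X}"
  have "unitization_sandwich X \<subseteq> ?T"
  proof (rule sandwich_least)
    fix l m and a b x :: 'a assume x: "x \<in> X"
    have "p * (cscale l (cscale m x) + cscale l (x * b) + cscale m (a * x) + a * x * b) * q =
        (cscale l p + p * a) * x * (cscale m q + b * q)" for p q
      by (simp add: algebra_simps cscale_linear cscale_mult_left' cscale_mult_right' cscale_cscale)
    then show "cscale l (cscale m x) + cscale l (x * b) + cscale m (a * x) + a * x * b \<in> ?T"
      using triple_prod_base[OF x] by auto
  next
    show "add_subgroup ?T"
      using two_sided_idealD(1)[OF two_sided_ideal_transporter(1)[OF two_sided_ideal_triple_prod]] .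
  qed
  then show "b * y * d \<in> triple_prod X" using assms by blast
qed

text \<open>Otherwise the transporter ideal, which visibly contains \<open>?LL\<close>, is proper
  and lies in a prime ideal P avoiding some element. The lemma on squares of ad is applied twice,
  first to a in L and then to arbitrary a, and puts every commutator into P.\<close>

lemma triple_prod_comm_commutators_eq_UNIV:
  assumes "triple_prod commutators = (UNIV :: 'a::cstar_algebra set)"
  shows "triple_prod (comm_set commutators commutators) = (UNIV :: 'a set)"
proof (rule ideal_eq_UNIV_of_transporter[OF two_sided_ideal_triple_prod], rule ccontr)
  let ?LL = "comm_set commutators commutators :: 'a set"
  let ?I = "{y. \<forall>b d. b * y * d \<in> triple_prod ?LL}"
  fix b y d :: 'a assume "b * y * d \<notin> triple_prod ?LL"
  then have I': "?I \<noteq> UNIV" by blast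
  have I: "two_sided_ideal ?I"
    by (rule two_sided_ideal_transporter(1)[OF two_sided_ideal_triple_prod])
  obtain x where x: "\<And>m n. x m * x n = x (Suc (m + n))" "\<And>n::nat. x n \<notin> ?I"
    by (rule proper_ideal_avoids_powers[OF I I']) (rule that)
  obtain P where prime: "prime_ideal P" and sub: "?I \<subseteq> P" and x_P: "\<And>n. x n \<notin> P"
    by (rule exists_prime_ideal_avoiding_powers[OF I x(2,1)]) (rule that)
  then have P: "two_sided_ideal P" by (simp add: prime_ideal_def)
  have LL: "z \<in> P" if "z \<in> ?LL" for z
    using that sub triple_prod_base[of z ?LL] by blast
  have ad: "commutator a z \<in> P" if "a \<in> commutators" for a z
    by (rule prime_ideal_ad_square_zero[OF prime])
      (auto intro!: LL comm_set_base that commutator_in_commutators)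
  have "commutator a z \<in> P" for a z
  proof (rule prime_ideal_ad_square_zero[OF prime])
    fix z
    have "commutator a (commutator a z) = - commutator (commutator a z) a"
      by (simp add: commutator_def)
    then show "commutator a (commutator a z) \<in> P"
      using ad[OF commutator_in_commutators] add_subgroupD(3)[OF two_sided_idealD(1)[OF P]] by metis
  qed
  then have "commutators \<subseteq> P"
    by (intro comm_set_least two_sided_idealD(1)[OF P])
  then have "triple_prod commutators \<subseteq> P"
    using two_sided_idealD[OF P] by (intro triple_prod_least) auto
  then show False using assms x_P by blast
qed

lemma ring_gen_eq_UNIV:
  assumes "prod_set commutators commutators = (UNIV :: 'a::ring set)"
  shows "ring_gen {commutator x y | x y. True} = (UNIV :: 'a set)"
proof -
  let ?R = "ring_gen {commutator x y | x y. True} :: 'a set"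
  have R: "add_subgroup ?R" by (simp add: add_subgroup_def ring_gen.intros)
  have "commutators \<subseteq> ?R"
    by (rule comm_set_least[OF _ R]) (auto intro: ring_gen.base)
  then have "prod_set commutators commutators \<subseteq> ?R"
    by (intro prod_set_least R ring_gen.mult) auto
  then show ?thesis using assms by blast
qed

text \<open>The sandwich is a right ideal containing the commutators, hence it contains the ring
  they generate.\<close>

lemma sandwich_eq_UNIV:
  assumes "ring_gen {commutator x y | x y. True} = (UNIV :: 'a::cstar_algebra set)"
  shows "unitization_sandwich commutators = (UNIV :: 'a set)"
proof -
  let ?S = "unitization_sandwich commutators :: 'a set"
  note S = add_subgroupD[OF add_subgroup_sandwich[of "commutators :: 'a set"]]
  have gen: "cscale l (cscale m x) + cscale l (x * b) + cscale m (a * x) + a * x * b \<in> ?S"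
    if "x \<in> commutators" for l m a b x
    unfolding unitization_sandwich_def using that by (intro add_gen_base) blast
  have right: "x * y \<in> ?S" if "x \<in> ?S" for x y
  proof -
    have "?S \<subseteq> {x. x * y \<in> ?S}"
    proof (rule sandwich_least)
      fix l m and a b x :: 'a assume "x \<in> commutators"
      \<comment> \<open>Right multiplication by y turns the factor m + b into the element m y + b y
        of the algebra, so the new right scalar is 0.\<close>
      from gen[OF this, of l 0 "cscale m y + b * y" a]
      show "cscale l (cscale m x) + cscale l (x * b) + cscale m (a * x) + a * x * b \<in> {x. x * y \<in> ?S}"
        by (simp add: algebra_simps cscale_linear cscale_mult_left' cscale_mult_right' cscale_cscale)
    qed (use S in \<open>auto simp: add_subgroup_def left_diff_distrib\<close>)
    then show ?thesis using that by blast
  qed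
  have "x \<in> ?S" if "x \<in> ring_gen {commutator x y | x y. True}" for x :: 'a
    using that
  proof (induction rule: ring_gen.induct)
    case (base x)
    then obtain u v where "x = commutator u v" by blast
    then show ?case
      using gen[OF commutator_in_commutators, of 1 1 u v 0 0]
      by (simp add: cscale_one)
  qed (use S right in auto)
  then show ?thesis using assms by blast
qed

section \<open>Characters\<close>

text \<open>With e = f(h) the expression is (1 - e) h (1 - e), the value at h of t (1 - f(t))^2.
  That function is 0 for \<bar>t\<bar> \<ge> \<delta> and of absolute value at most \<bar>t\<bar>
  otherwise.\<close>

lemma (in sa_contraction) approximate_unit:
  assumes "0 < \<delta>"
  obtains e where "cstar e = e" "norm e \<le> 1" "norm (h - e * h - h * e + e * h * e) \<le> \<delta>"
proof -
  let ?f = "\<lambda>t. min 1 (\<bar>t\<bar> / \<delta>)"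
  note c = cont0_cutoff(1)[OF assms]
  have "norm (fc (\<lambda>t. t - ?f t * t - t * ?f t + ?f t * t * ?f t)) \<le> \<delta>"
  proof (rule fc_norm_le)
    fix t :: real
    have "t - ?f t * t - t * ?f t + ?f t * t * ?f t = t * (1 - ?f t)\<^sup>2"
      by (simp add: power2_eq_square algebra_simps)
    also have "\<bar>\<dots>\<bar> \<le> \<delta>"
    proof (cases "\<delta> \<le> \<bar>t\<bar>")
      case False
      then have "(1 - ?f t)\<^sup>2 \<le> 1" using assms by (intro power_le_one) (auto simp: min_def)
      then have "\<bar>t\<bar> * (1 - ?f t)\<^sup>2 \<le> \<delta> * 1" using False assms by (intro mult_mono) auto
      then show ?thesis by (simp add: abs_mult)
    qed (use assms in \<open>simp add: min_def\<close>)
    finally show "\<bar>t - ?f t * t - t * ?f t + ?f t * t * ?f t\<bar> \<le> \<delta>" .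
  qed (use c in auto)
  also have "fc (\<lambda>t. t - ?f t * t - t * ?f t + ?f t * t * ?f t) = h - fc ?f * h - h * fc ?f + fc ?f * h * fc ?f"
    by (simp only: fc_add fc_diff fc_mult fc_ident cont0_intros c)
  finally have "norm (h - fc ?f * h - h * fc ?f + fc ?f * h * fc ?f) \<le> \<delta>" .
  moreover have "norm (fc ?f) \<le> 1" using assms by (intro fc_norm_le c) auto
  ultimately show ?thesis using that fc_selfadjoint[OF c] by blast
qed

text \<open>For a rescaled x, called z, the C*-identity turns the squared norm of z - z e into the
  norm of (1 - e) \<open>cstar z * z\<close> (1 - e), which the selfadjoint case makes
  small.\<close>

lemma approximate_right_unit:
  fixes x :: "'a::cstar_algebra"
  assumes "0 < \<delta>"
  obtains e where "norm e \<le> 1" "norm (x - x * e) \<le> \<delta>"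
proof -
  define r where "r = 1 / (norm x + 1)"
  have n: "norm x + 1 > 0" using norm_ge_zero[of x] by linarith
  then have r: "r > 0" "r * norm x < 1" by (auto simp: r_def)
  define z where "z = r *\<^sub>R x"
  let ?h = "cstar z * z"
  have "norm z < 1" using r by (simp add: z_def)
  then have h: "sa_contraction ?h"
    by (simp add: sa_contraction_def cstar_identity cstar_mult cstar_cstar abs_square_less_1)
  have "0 < (r * \<delta>)\<^sup>2" using assms r by simp
  then obtain e where e: "cstar e = e" "norm e \<le> 1"
    "norm (?h - e * ?h - ?h * e + e * ?h * e) \<le> (r * \<delta>)\<^sup>2"
    by (rule sa_contraction.approximate_unit[OF h]) (rule that)
  have "(norm (z - z * e))\<^sup>2 = norm (cstar (z - z * e) * (z - z * e))"
    by (simp add: cstar_identity)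
  also have "cstar (z - z * e) * (z - z * e) = ?h - e * ?h - ?h * e + e * ?h * e"
    by (simp only: cstar_diff cstar_mult e(1)) (simp add: algebra_simps)
  also have "norm \<dots> \<le> (r * \<delta>)\<^sup>2" by (rule e(3))
  finally have "norm (z - z * e) \<le> r * \<delta>"
    by (rule power2_le_imp_le) (use assms r in simp)
  moreover have "norm (z - z * e) = r * norm (x - x * e)"
    using r by (simp add: z_def flip: scaleR_diff_right)
  ultimately show ?thesis using that e(2) r by simp
qed

lemma approximate_left_unit:
  fixes x :: "'a::cstar_algebra"
  assumes "0 < \<delta>"
  obtains e where "norm e \<le> 1" "norm (x - e * x) \<le> \<delta>"
proof -
  obtain e where e: "norm e \<le> 1" "norm (cstar x - cstar x * e) \<le> \<delta>"
    using approximate_right_unit[OF assms] .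
  have "cstar (cstar x - cstar x * e) = x - cstar e * x"
    by (simp add: cstar_diff cstar_mult cstar_cstar)
  then have "norm (x - cstar e * x) \<le> \<delta>" using e(2) norm_cstar by metis
  then show ?thesis using that[of "cstar e"] e(1) by simp
qed

text \<open>x is a limit of elements e' x e formed with approximate left and right units.\<close>

lemma closed_ideal_memI:
  fixes I :: "'a::cstar_algebra set"
  assumes "closed I" and mem: "\<And>a b. a * x * b \<in> I"
  shows "x \<in> I"
proof -
  have "\<exists>y\<in>I. dist y x < \<epsilon>" if "\<epsilon> > 0" for \<epsilon>
  proof -
    have \<epsilon>: "\<epsilon> / 3 > 0" using that by simp
    obtain e where e: "norm e \<le> 1" "norm (x - x * e) \<le> \<epsilon> / 3" using approximate_right_unit[OF \<epsilon>] .
    obtain e' where e': "norm e' \<le> 1" "norm (x - e' * x) \<le> \<epsilon> / 3" using approximate_left_unit[OF \<epsilon>] .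
    have "norm ((x - e' * x) * e) \<le> \<epsilon> / 3 * 1"
      using e e' \<epsilon> by (intro order_trans[OF norm_mult_ineq] mult_mono) auto
    then have "norm ((x - x * e) + (x - e' * x) * e) < \<epsilon>"
      using e(2) that by (intro norm_triangle_lt) auto
    then have "dist (e' * x * e) x < \<epsilon>"
      by (simp add: dist_norm norm_minus_commute algebra_simps)
    then show ?thesis using mem by blast
  qed
  then have "x \<in> closure I" by (simp add: closure_approachable)
  then show ?thesis using \<open>closed I\<close> by simp
qed

text \<open>Between two factors the scalar can be shifted from x onto the left factor, where the
  ring ideal property suffices.\<close>

lemma closed_ideal_cscale:
  fixes I :: "'a::cstar_algebra set"
  assumes "closed I" "two_sided_ideal I" "x \<in> I"
  shows "cscale c x \<in> I"
proof (rule closed_ideal_memI[OF assms(1)])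
  fix a b
  have "a * cscale c x * b = cscale c a * x * b" by (simp add: cscale_mult_left' cscale_mult_right')
  then show "a * cscale c x * b \<in> I" using assms two_sided_idealD[OF assms(2)] by simp
qed

lemma two_sided_ideal_closure:
  fixes I :: "'a::cstar_algebra set"
  assumes "two_sided_ideal I"
  shows "two_sided_ideal (closure I)"
proof (rule two_sided_idealI)
  note D = two_sided_idealD[OF assms] add_subgroupD[OF two_sided_idealD(1)[OF assms]]
  have lim: "z \<in> closure I" if "\<And>n::nat. f n \<in> I" "f \<longlonglongrightarrow> z" for f z
    unfolding closure_sequential using that by blast
  show "0 \<in> closure I" by (rule subsetD[OF closure_subset D(4)])
  fix x assume "x \<in> closure I"
  then obtain f where f: "\<And>n. f n \<in> I" "f \<longlonglongrightarrow> x" by (auto simp: closure_sequential)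
  show "r * x \<in> closure I" for r
    by (rule lim[of "\<lambda>n. r * f n"]) (intro D(2) f tendsto_intros)+
  show "x * r \<in> closure I" for r
    by (rule lim[of "\<lambda>n. f n * r"]) (intro D(3) f tendsto_intros)+
  fix y assume "y \<in> closure I"
  then obtain g where g: "\<And>n. g n \<in> I" "g \<longlonglongrightarrow> y" by (auto simp: closure_sequential)
  show "x - y \<in> closure I"
    by (rule lim[of "\<lambda>n. f n - g n"]) (intro D(5) f g tendsto_intros)+
qed

text \<open>The fixed point y = d + d y of d = e - m satisfies d = (y - e y) + m y.\<close>
lemma modular_ideal_not_near_unit:
  fixes e m :: "'a::cstar_algebra"
  assumes I: "two_sided_ideal I" and unit: "\<And>y. y - e * y \<in> I" and m: "m \<in> I" "norm (e - m) < 1"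
  shows "e \<in> I"
proof -
  note D = two_sided_idealD[OF I] add_subgroupD[OF two_sided_idealD(1)[OF I]]
  let ?d = "e - m"
  have "\<exists>!y\<in>UNIV. ?d + ?d * y = y"
  proof (rule Banach_fix[where c = "norm ?d"])
    fix x y :: 'a
    have "?d + ?d * x - (?d + ?d * y) = ?d * (x - y)" by (simp add: algebra_simps)
    then show "dist (?d + ?d * x) (?d + ?d * y) \<le> norm ?d * dist x y"
      unfolding dist_norm by (simp only: norm_mult_ineq)
  qed (use m in \<open>auto simp: complete_UNIV\<close>)
  then obtain y where "?d + ?d * y = y" by blast
  then have "e = (y - e * y) + m * y + m" by (simp add: algebra_simps)
  then show ?thesis using D unit m(1) by metis
qed

lemma add_subgroup_sum:
  assumes "add_subgroup G" "\<And>i. i \<in> S \<Longrightarrow> f i \<in> G"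
  shows "(\<Sum>i\<in>S. f i) \<in> G"
  using assms(2) by (induction S rule: infinite_finite_induct) (auto intro: add_subgroupD[OF assms(1)])

text \<open>Modulo \<open>M\<close> the algebra is commutative with identity e, and maximality among
  the ideals missing e makes the quotient a field. The aim is to identify this field with the
  complex numbers.\<close>

locale maximal_modular_ideal =
  fixes M :: "'a::cstar_algebra set" and e :: 'a
  assumes ideal: "two_sided_ideal M"
    and unit_notin: "e \<notin> M"
    and unit: "y - e * y \<in> M"
    and commute: "a * b - b * a \<in> M"
    and maximal: "two_sided_ideal N \<Longrightarrow> M \<subseteq> N \<Longrightarrow> e \<notin> N \<Longrightarrow> N = M"
begin

lemmas D = two_sided_idealD[OF ideal] add_subgroupD[OF two_sided_idealD(1)[OF ideal]]

text \<open>The set M + A c is an ideal because commutators lie in M; it contains c modulo the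
  identity e, so it exceeds M and by maximality contains e.\<close>

lemma invertible_mod:
  assumes "c \<notin> M"
  obtains b where "e - b * c \<in> M"
proof -
  let ?N = "{y. \<exists>b. y - b * c \<in> M}"
  have "two_sided_ideal ?N"
  proof (rule two_sided_idealI)
    show "0 \<in> ?N" using D(4) by (auto intro!: exI[of _ 0])
    fix x r assume "x \<in> ?N"
    then obtain b where b: "x - b * c \<in> M" by blast
    have "r * x - (r * b) * c = r * (x - b * c)" by (simp add: algebra_simps)
    then show "r * x \<in> ?N" using D(2)[OF b] by (metis mem_Collect_eq)
    have "x * r - (b * r) * c = (x - b * c) * r + b * (c * r - r * c)" by (simp add: algebra_simps)
    then show "x * r \<in> ?N" using D(7)[OF D(3)[OF b] D(2)[OF commute]] by (metis mem_Collect_eq)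
    fix y assume "y \<in> ?N"
    then obtain b' where b': "y - b' * c \<in> M" by blast
    have "x - y - (b - b') * c = (x - b * c) - (y - b' * c)" by (simp add: algebra_simps)
    then show "x - y \<in> ?N" using D(5)[OF b b'] by (metis mem_Collect_eq)
  qed
  moreover have "M \<subseteq> ?N" by (auto intro!: exI[of _ 0])
  moreover have "c \<in> ?N" using unit[of c] by blast
  ultimately have "e \<in> ?N" using maximal[of ?N] assms by blast
  then show ?thesis using that by blast
qed

text \<open>No element of M is at distance less than 1 from e, so the closure still misses e and
  equals M by maximality.\<close>

lemma closed_ideal: "closed M"
proof -
  have "e \<notin> closure M"
  proof
    assume "e \<in> closure M"
    then obtain m where "m \<in> M" "dist m e < 1" unfolding closure_approachable by (meson zero_less_one)
    then show False
      using modular_ideal_not_near_unit[OF ideal unit, of m] unit_notin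
      by (simp add: dist_norm norm_minus_commute)
  qed
  then have "closure M = M"
    using maximal two_sided_ideal_closure[OF ideal] closure_subset by blast
  then show ?thesis by (metis closed_closure)
qed

lemma cscale_mem: "x \<in> M \<Longrightarrow> cscale c x \<in> M"
  using closed_ideal_cscale[OF closed_ideal ideal] .

lemma scaleR_mem: "x \<in> M \<Longrightarrow> r *\<^sub>R x \<in> M"
  using cscale_mem[of x "of_real r"] by (simp add: cscale_of_real)

text \<open>If b inverts \<open>a - \<mu>\<close> modulo M, then \<open>\<phi>(a) = b\<^sup>k (a - \<mu>)\<^sup>k \<phi>(a)\<close> modulo M. This becomes
  arbitrarily small as soon as \<open>\<phi>\<close> is supported close to \<open>\<mu>\<close>.\<close>
lemma fc_mem_of_local_support:
  assumes a: "sa_contraction a" and b: "e - b * (a - \<mu> *\<^sub>R e) \<in> M" and "cont0 \<phi>"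
    and supp: "\<And>t. t \<in> {-1..1} \<Longrightarrow> \<phi> t \<noteq> 0 \<Longrightarrow> 2 * norm b * \<bar>t - \<mu>\<bar> \<le> 1"
  shows "sa_contraction.fc a \<phi> \<in> M"
proof -
  interpret sa_contraction a by (rule a)
  have small: "\<exists>z. fc \<phi> - z \<in> M \<and> norm z \<le> S / 2 ^ k"
    if "cont0 \<phi>" "\<And>t. t \<in> {-1..1} \<Longrightarrow> \<phi> t \<noteq> 0 \<Longrightarrow> 2 * norm b * \<bar>t - \<mu>\<bar> \<le> 1"
      "\<And>t. t \<in> {-1..1} \<Longrightarrow> \<bar>\<phi> t\<bar> \<le> S" for \<phi> S k
    using that
  proof (induction k arbitrary: \<phi> S)
    case 0
    have "norm (fc \<phi>) \<le> S" by (rule fc_norm_le[OF 0(1,3)])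
    then show ?case using D(4) by (intro exI[of _ "fc \<phi>"]) simp
  next
    case (Suc k)
    show ?case
    proof (cases "b = 0")
      case True
      then show ?thesis using b unit_notin by simp
    next
      case False
      let ?\<psi> = "\<lambda>t. t * \<phi> t - \<mu> * \<phi> t"
      have "\<bar>?\<psi> t\<bar> \<le> S / (2 * norm b)" if t: "t \<in> {-1..1}" for t
      proof (cases "\<phi> t = 0")
        case True
        then show ?thesis using Suc.prems(3)[OF t] by simp
      next
        case False
        have "\<bar>?\<psi> t\<bar> * (2 * norm b) = \<bar>\<phi> t\<bar> * (2 * norm b * \<bar>t - \<mu>\<bar>)"
          by (simp flip: left_diff_distrib add: abs_mult)
        also have "\<dots> \<le> S * 1"
          using Suc.prems(2,3)[OF t] False by (intro mult_mono) auto
        finally show ?thesis using \<open>b \<noteq> 0\<close> by (simp add: le_divide_eq)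
      qed
      moreover have c: "cont0 ?\<psi>" using Suc.prems(1) by auto
      moreover have "2 * norm b * \<bar>t - \<mu>\<bar> \<le> 1" if "t \<in> {-1..1}" "?\<psi> t \<noteq> 0" for t
        using Suc.prems(2)[of t] that by auto
      ultimately obtain z where z: "fc ?\<psi> - z \<in> M" "norm z \<le> S / (2 * norm b) / 2 ^ k"
        using Suc.IH by blast
      have eq: "fc ?\<psi> = a * fc \<phi> - \<mu> *\<^sub>R fc \<phi>"
        using Suc.prems(1) by (simp add: fc_diff fc_mult fc_scale fc_ident)
      \<comment> \<open>Modulo M, \<phi>(a) = e \<phi>(a) = b (a - \<mu> e) \<phi>(a) = b \<psi>(a),
        and \<psi>(a) is replaced by its small representative z. The factor \<open>norm b\<close>
        cancels against the bound for \<psi> and leaves the factor 1/2.\<close>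
      have "fc \<phi> - b * z = (fc \<phi> - e * fc \<phi>) + (e - b * (a - \<mu> *\<^sub>R e)) * fc \<phi>
          + b * (\<mu> *\<^sub>R (fc \<phi> - e * fc \<phi>)) + b * (fc ?\<psi> - z)"
        by (simp only: eq) (simp add: algebra_simps)
      moreover have "\<dots> \<in> M"
        by (intro D unit b scaleR_mem z)
      moreover have "norm (b * z) \<le> S / 2 ^ Suc k"
      proof -
        have "norm (b * z) \<le> norm b * (S / (2 * norm b) / 2 ^ k)"
          using z(2) by (intro order_trans[OF norm_mult_ineq] mult_left_mono) auto
        then show ?thesis using False by simp
      qed
      ultimately show ?thesis by metis
    qed
  qed
  obtain S where S: "\<forall>t\<in>{-1..1}. \<bar>\<phi> t\<bar> \<le> S"
    using cont0_bounded[OF \<open>cont0 \<phi>\<close>] by (auto simp: bounded_iff)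
  have "\<forall>k. \<exists>z. fc \<phi> - z \<in> M \<and> norm z \<le> S / 2 ^ k"
    using small[OF \<open>cont0 \<phi>\<close> supp S[rule_format]] by simp
  from choice[OF this] obtain z where "\<forall>k. fc \<phi> - z k \<in> M \<and> norm (z k) \<le> S / 2 ^ k" ..
  then have z: "\<And>k. fc \<phi> - z k \<in> M" "\<And>k. norm (z k) \<le> S / 2 ^ k" by simp_all
  have "(\<lambda>k. S / 2 ^ k) \<longlonglongrightarrow> 0" by (rule LIMSEQ_divide_realpow_zero) simp
  moreover have "\<forall>\<^sub>F k in sequentially. norm (z k) \<le> S / 2 ^ k"
    by (intro always_eventually allI z(2))
  ultimately have "z \<longlonglongrightarrow> 0" by (rule Lim_null_comparison[rotated])
  then have "(\<lambda>k. fc \<phi> - z k) \<longlonglongrightarrow> fc \<phi> - 0" by (intro tendsto_intros)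
  then show ?thesis using closed_sequentially[OF closed_ideal z(1)] by simp
qed

text \<open>If every a - \<mu> e were invertible modulo M, functions supported near any \<mu> would
  have their values at a in M. A partition of unity writes the identity function as a finite sum of
  such functions, so a itself would lie in M.\<close>

lemma selfadjoint_scalar_mod:
  assumes a: "sa_contraction a"
  shows "\<exists>\<mu>::real. a - \<mu> *\<^sub>R e \<in> M"
proof (rule ccontr)
  interpret sa_contraction a by (rule a)
  assume no: "\<not> (\<exists>\<mu>::real. a - \<mu> *\<^sub>R e \<in> M)"
  then have "\<exists>b. e - b * (a - \<mu> *\<^sub>R e) \<in> M" for \<mu> using invertible_mod by metis
  then obtain b where b: "\<And>\<mu>. e - b \<mu> * (a - \<mu> *\<^sub>R e) \<in> M" by metis
  \<comment> \<open>The radius makes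
    \<open>2 * norm (b \<mu>) * \<bar>t - \<mu>\<bar> \<le> 1\<close> on the ball; adding 1 keeps
    the denominator positive.\<close>
  define B where "B \<mu> = ball \<mu> (1 / (2 * (norm (b \<mu>) + 1)))" for \<mu>
  have pos: "norm (b \<mu>) + 1 > 0" for \<mu> using norm_ge_zero[of "b \<mu>"] by linarith
  have mem: "fc \<phi> \<in> M" if "cont0 \<phi>" "\<And>t. t \<in> {-1..1} \<Longrightarrow> t \<notin> B \<mu> \<Longrightarrow> \<phi> t = 0" for \<phi> \<mu>
  proof (rule fc_mem_of_local_support[OF a b \<open>cont0 \<phi>\<close>])
    fix t :: real assume "t \<in> {-1..1}" "\<phi> t \<noteq> 0"
    then have "t \<in> B \<mu>" using that(2) by blast
    then have "\<bar>t - \<mu>\<bar> * (2 * (norm (b \<mu>) + 1)) < 1"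
      using pos[of \<mu>] by (simp add: B_def dist_real_def abs_minus_commute less_divide_eq)
    moreover have "2 * norm (b \<mu>) * d \<le> d * (2 * (norm (b \<mu>) + 1))" if "0 \<le> d" for d
      using that by (simp add: algebra_simps)
    from this[OF abs_ge_zero] have
      "2 * norm (b \<mu>) * \<bar>t - \<mu>\<bar> \<le> \<bar>t - \<mu>\<bar> * (2 * (norm (b \<mu>) + 1))" .
    ultimately show "2 * norm (b \<mu>) * \<bar>t - \<mu>\<bar> \<le> 1" by linarith
  qed
  have "t \<in> B t" for t using pos[of t] by (simp add: B_def)
  then have "{-1..1} \<subseteq> \<Union>(range B)" by blast
  then obtain \<C> where C: "\<C> \<subseteq> range B" "finite \<C>" "{-1..1} \<subseteq> \<Union>\<C>"
    using compactE[of "{-1..1::real}" "range B"] by (auto simp: B_def)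
  obtain F :: "real set \<Rightarrow> real \<Rightarrow> real" where F: "\<And>U. U \<in> \<C> \<Longrightarrow> continuous_on {-1..1} (F U)"
    "\<And>t U. U \<in> \<C> \<Longrightarrow> t \<in> {-1..1} \<Longrightarrow> t \<notin> U \<Longrightarrow> F U t = 0"
    "\<And>t. t \<in> {-1..1} \<Longrightarrow> supp_sum (\<lambda>W. F W t) \<C> = 1"
  proof (rule subordinate_partition_of_unity[OF C(3)])
    show "open T" if "T \<in> \<C>" for T using that C(1) by (auto simp: B_def)
    show "\<exists>V. open V \<and> t \<in> V \<and> finite {U \<in> \<C>. U \<inter> V \<noteq> {}}" for t
      using C(2) by (intro exI[of _ UNIV]) auto
    fix F :: "real set \<Rightarrow> real \<Rightarrow> real"
    assume "\<And>U. U \<in> \<C> \<Longrightarrow> continuous_on {-1..1} (F U) \<and> (\<forall>t\<in>{-1..1}. 0 \<le> F U t)"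
      "\<And>t U. U \<in> \<C> \<Longrightarrow> t \<in> {-1..1} \<Longrightarrow> t \<notin> U \<Longrightarrow> F U t = 0"
      "\<And>t. t \<in> {-1..1} \<Longrightarrow> supp_sum (\<lambda>W. F W t) \<C> = 1"
    then show thesis by (intro that[of F]) simp_all
  qed
  have one: "(\<Sum>W\<in>\<C>. F W t) = 1" if "t \<in> {-1..1}" for t
  proof -
    have "(\<Sum>W\<in>\<C>. F W t) = supp_sum (\<lambda>W. F W t) \<C>"
      unfolding supp_sum_def by (rule sum.mono_neutral_right[OF C(2)]) (auto simp: support_on_def)
    then show ?thesis using F(3)[OF that] by simp
  qed
  \<comment> \<open>The factor t makes each piece vanish at 0, which the partition functions
    themselves need not do.\<close>
  have c: "cont0 (\<lambda>t. t * F W t)" if "W \<in> \<C>" for W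
    using F(1)[OF that] by (auto simp: cont0_def intro!: continuous_intros)
  have sum: "fc (\<lambda>t. \<Sum>W\<in>\<C>. t * F W t) = (\<Sum>W\<in>\<C>. fc (\<lambda>t. t * F W t))
      \<and> cont0 (\<lambda>t. \<Sum>W\<in>\<C>. t * F W t)"
    by (rule fc_sum[OF C(2)]) (rule c)
  have "fc (\<lambda>t. t) = fc (\<lambda>t. \<Sum>W\<in>\<C>. t * F W t)"
  proof (rule fc_cong)
    show "cont0 (\<lambda>t. \<Sum>W\<in>\<C>. t * F W t)" using sum by blast
    show "t = (\<Sum>W\<in>\<C>. t * F W t)" if "t \<in> {-1..1}" for t
      using one[OF that] by (simp flip: sum_distrib_left)
  qed simp
  also have "\<dots> = (\<Sum>W\<in>\<C>. fc (\<lambda>t. t * F W t))" using sum by blast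
  also have "\<dots> \<in> M"
  proof (rule add_subgroup_sum[OF D(1)])
    fix W assume W: "W \<in> \<C>"
    then obtain \<mu> where "W = B \<mu>" using C(1) by blast
    then show "fc (\<lambda>t. t * F W t) \<in> M" using F(2)[OF W] by (intro mem[of _ \<mu>] c W) auto
  qed
  finally have "a - 0 *\<^sub>R e \<in> M" by (simp add: fc_ident)
  then show False using no by blast
qed

lemma scalar_mod: "\<exists>\<mu>. a - cscale \<mu> e \<in> M"
proof -
  obtain c h k where *: "sa_contraction h" "sa_contraction k" "a = cscale c h + cscale (c * \<i>) k"
    by (rule sa_decomposition)
  obtain s t :: real where st: "h - s *\<^sub>R e \<in> M" "k - t *\<^sub>R e \<in> M"
    using selfadjoint_scalar_mod *(1,2) by blast
  have "a - cscale (c * s + c * \<i> * t) e = cscale c (h - s *\<^sub>R e) + cscale (c * \<i>) (k - t *\<^sub>R e)"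
    by (simp add: *(3) cscale_linear cscale_cscale flip: cscale_of_real)
  also have "\<dots> \<in> M" by (intro D(7) cscale_mem st)
  finally show ?thesis by blast
qed

lemma scalar_mod_unique:
  assumes "a - cscale \<mu> e \<in> M" "a - cscale \<nu> e \<in> M"
  shows "\<mu> = \<nu>"
proof (rule ccontr)
  assume "\<mu> \<noteq> \<nu>"
  have "cscale (\<nu> - \<mu>) e = (a - cscale \<mu> e) - (a - cscale \<nu> e)" by (simp add: cscale_linear)
  also have "\<dots> \<in> M" by (intro D(5) assms)
  finally have "cscale (\<nu> - \<mu>) e \<in> M" .
  from cscale_mem[OF this, of "1 / (\<nu> - \<mu>)"] show False
    using \<open>\<mu> \<noteq> \<nu>\<close> unit_notin by (simp add: cscale_cscale cscale_one)
qed

text \<open>Sending a to the unique scalar it represents modulo M is the quotient map, so each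
  algebraic law follows from uniqueness.\<close>

lemma exists_character: "\<exists>\<phi>::'a \<Rightarrow> complex. is_character \<phi>"
proof -
  have "\<forall>a. \<exists>\<mu>. a - cscale \<mu> e \<in> M" by (intro allI scalar_mod)
  from choice[OF this] obtain \<phi> where "\<forall>a. a - cscale (\<phi> a) e \<in> M" ..
  then have \<phi>: "\<And>a. a - cscale (\<phi> a) e \<in> M" by simp
  have eqI: "\<phi> a = \<mu>" if "a - cscale \<mu> e \<in> M" for a \<mu>
    by (rule scalar_mod_unique[OF \<phi> that])
  have "\<phi> (x + y) = \<phi> x + \<phi> y" for x y
  proof (rule eqI)
    have "x + y - cscale (\<phi> x + \<phi> y) e = (x - cscale (\<phi> x) e) + (y - cscale (\<phi> y) e)"
      by (simp add: cscale_linear)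
    also have "\<dots> \<in> M" by (intro D(7) \<phi>)
    finally show "x + y - cscale (\<phi> x + \<phi> y) e \<in> M" .
  qed
  moreover have "\<phi> (cscale c x) = c * \<phi> x" for c x
  proof (rule eqI)
    have "cscale c x - cscale (c * \<phi> x) e = cscale c (x - cscale (\<phi> x) e)"
      by (simp add: cscale_linear cscale_cscale)
    also have "\<dots> \<in> M" by (intro cscale_mem \<phi>)
    finally show "cscale c x - cscale (c * \<phi> x) e \<in> M" .
  qed
  moreover have "\<phi> (x * y) = \<phi> x * \<phi> y" for x y
  proof (rule eqI)
    have "x * y - cscale (\<phi> x * \<phi> y) e = (x - cscale (\<phi> x) e) * y
        + cscale (\<phi> x) ((y - cscale (\<phi> y) e) - (y - e * y))"
      by (simp add: algebra_simps cscale_linear cscale_cscale cscale_mult_left')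
    also have "\<dots> \<in> M" by (intro D(3,5,7) cscale_mem \<phi> unit)
    finally show "x * y - cscale (\<phi> x * \<phi> y) e \<in> M" .
  qed
  moreover have "\<phi> e = 1" by (rule eqI) (simp add: cscale_one D)
  ultimately show ?thesis unfolding is_character_def by (intro exI[of _ \<phi>] conjI allI exI[of _ e]) simp_all
qed

end

section \<open>A character from a commutator ideal that is not dense\<close>

lemma closure_triple_prod_commutators:
  assumes "\<not> (\<exists>\<phi>::'a::cstar_algebra \<Rightarrow> complex. is_character \<phi>)"
  shows "closure (triple_prod commutators) = (UNIV :: 'a set)"
proof (rule ccontr)
  let ?J = "closure (triple_prod commutators) :: 'a set"
  assume "?J \<noteq> UNIV"
  have J: "two_sided_ideal ?J" by (intro two_sided_ideal_closure two_sided_ideal_triple_prod)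
  note D = two_sided_idealD[OF J] add_subgroupD[OF two_sided_idealD(1)[OF J]]
  \<comment> \<open>Commutators are not assumed to lie in A L A, but all their two-sided multiples
    do, and \<open>?J\<close> is closed.\<close>
  have comm: "a * b - b * a \<in> ?J" for a b
  proof (rule closed_ideal_memI)
    fix c d
    have "c * commutator a b * d \<in> triple_prod commutators"
      by (rule triple_prod_base[OF commutator_in_commutators])
    then show "c * (a * b - b * a) * d \<in> ?J" using closure_subset by (auto simp: commutator_def)
  qed simp
  have "\<exists>h. sa_contraction h \<and> h \<notin> ?J"
  proof (rule ccontr)
    assume no: "\<not> ?thesis"
    have "a \<in> ?J" for a
    proof -
      obtain c h k where *: "sa_contraction h" "sa_contraction k" "a = cscale c h + cscale (c * \<i>) k"
        by (rule sa_decomposition)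
      then have "cscale c h \<in> ?J" "cscale (c * \<i>) k \<in> ?J"
        using no by (auto intro!: closed_ideal_cscale J)
      then show ?thesis using *(3) D(7) by simp
    qed
    then show False using \<open>?J \<noteq> UNIV\<close> by blast
  qed
  then obtain h where h: "sa_contraction h" "h \<notin> ?J" by blast
  then obtain \<delta> where \<delta>: "\<delta> > 0" "ball h \<delta> \<subseteq> - ?J"
    by (metis ComplI closed_closure open_Compl open_contains_ball)
  \<comment> \<open>The tolerance is half the radius of a ball around h disjoint from
    \<open>?J\<close>, so g stays outside \<open>?J\<close>.\<close>
  obtain e g where eg: "e * g = g" "g * e = g" "norm (h - g) \<le> \<delta> / 2"
    using sa_contraction.local_unit[OF h(1), of "\<delta> / 2"] \<delta>(1) by auto
  have g: "g \<notin> ?J" using \<delta> eg(3) by (auto simp: dist_norm subset_iff)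
  \<comment> \<open>The sum of \<open>?J\<close> and the elements b - e b; closure under left
    multiplication uses that commutators lie in \<open>?J\<close>.\<close>
  let ?I = "{y. \<exists>b. y - (b - e * b) \<in> ?J}"
  have I: "two_sided_ideal ?I"
  proof (rule two_sided_idealI)
    show "0 \<in> ?I" using D(4) by (auto intro!: exI[of _ 0])
    fix x r assume "x \<in> ?I"
    then obtain b where b: "x - (b - e * b) \<in> ?J" by blast
    have "r * x - (r * b - e * (r * b)) = r * (x - (b - e * b)) + (e * r - r * e) * b"
      by (simp add: algebra_simps)
    also have "\<dots> \<in> ?J" by (intro D(7) D(2)[OF b] D(3)[OF comm])
    finally show "r * x \<in> ?I" by blast
    have "x * r - (b * r - e * (b * r)) = (x - (b - e * b)) * r" by (simp add: algebra_simps)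
    also have "\<dots> \<in> ?J" by (rule D(3)[OF b])
    finally show "x * r \<in> ?I" by blast
    fix y assume "y \<in> ?I"
    then obtain b' where b': "y - (b' - e * b') \<in> ?J" by blast
    have "x - y - ((b - b') - e * (b - b')) = (x - (b - e * b)) - (y - (b' - e * b'))"
      by (simp add: algebra_simps)
    also have "\<dots> \<in> ?J" by (rule D(5)[OF b b'])
    finally show "x - y \<in> ?I" by blast
  qed
  have "e \<notin> ?I"
  proof
    assume "e \<in> ?I"
    then obtain b where b: "e - (b - e * b) \<in> ?J" by blast
    \<comment> \<open>Multiplying on the left by g kills b - e b and fixes e up to g, so e in
      \<open>?I\<close> would put g into \<open>?J\<close>.\<close>
    have "g * (e - (b - e * b)) = g"
      by (simp add: right_diff_distrib eg flip: mult.assoc)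
    then show False using D(2)[OF b, of g] g by simp
  qed
  then have "?I \<inter> {e} = {}" by blast
  then obtain M where M: "two_sided_ideal M" "?I \<subseteq> M" "M \<inter> {e} = {}"
    and max: "\<And>N. two_sided_ideal N \<Longrightarrow> M \<subseteq> N \<Longrightarrow> N \<inter> {e} = {} \<Longrightarrow> N = M"
    by (rule exists_maximal_ideal_avoiding[OF I]) (rule that)
  have "maximal_modular_ideal M e"
  proof
    show "two_sided_ideal M" by fact
    show "e \<notin> M" using M(3) by blast
    show "y - e * y \<in> M" for y using M(2) D(4) by (force intro!: exI[of _ y])
    show "a * b - b * a \<in> M" for a b using M(2) comm[of a b] by (force intro!: exI[of _ 0])
    show "N = M" if "two_sided_ideal N" "M \<subseteq> N" "e \<notin> N" for N
      using max that by blast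
  qed
  then show False using maximal_modular_ideal.exists_character assms by blast
qed

lemma no_character_of_triple_prod:
  assumes "triple_prod commutators = (UNIV :: 'a::cstar_algebra set)"
  shows "\<not> (\<exists>\<phi>::'a \<Rightarrow> complex. is_character \<phi>)"
proof
  assume "\<exists>\<phi>::'a \<Rightarrow> complex. is_character \<phi>"
  then obtain \<phi> :: "'a \<Rightarrow> complex" where add: "\<And>x y. \<phi> (x + y) = \<phi> x + \<phi> y"
    and mult: "\<And>x y. \<phi> (x * y) = \<phi> x * \<phi> y" and nz: "\<exists>x. \<phi> x \<noteq> 0"
    unfolding is_character_def by blast
  have diff: "\<phi> (x - y) = \<phi> x - \<phi> y" for x y using add[of "x - y" y] by simp
  have zero: "\<phi> 0 = 0" using diff[of 0 0] by simp
  have G: "add_subgroup {x. \<phi> x = 0}" by (simp add: add_subgroup_def diff zero)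
  have "commutators \<subseteq> {x. \<phi> x = 0}"
    by (rule comm_set_least[OF _ G]) (simp add: commutator_def diff mult mult.commute)
  then have "triple_prod commutators \<subseteq> {x. \<phi> x = 0}"
    by (intro triple_prod_least G) (auto simp: mult)
  then show False using assms nz by auto
qed

text \<open>A dense ideal has an element at distance less than 1 from the identity, and the
  fixed-point argument for modular units then puts the identity into the ideal.\<close>

lemma dense_ideal_unital:
  assumes "unital_alg TYPE('a::cstar_algebra)" "two_sided_ideal I" "closure I = (UNIV :: 'a set)"
  shows "I = UNIV"
proof -
  obtain e :: 'a where e: "\<And>x. e * x = x \<and> x * e = x" using assms(1) by (auto simp: unital_alg_def)
  have "e \<in> closure I" using assms(3) by blast
  then obtain m where m: "m \<in> I" "dist m e < 1" unfolding closure_approachable by (meson zero_less_one)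
  have "e \<in> I"
    by (rule modular_ideal_not_near_unit[OF assms(2) _ m(1)])
      (use m(2) e add_subgroupD(1)[OF two_sided_idealD(1)[OF assms(2)]] in
        \<open>auto simp: dist_norm norm_minus_commute\<close>)
  then have "x \<in> I" for x using two_sided_idealD(3)[OF assms(2), of e x] e by simp
  then show ?thesis by blast
qed

theorem theorem4p1:
  fixes A :: "'a::cstar_algebra set"
  assumes "A = UNIV"
  defines "C \<equiv> comm_set A A"
  defines "c1 \<equiv> (A = unitization_sandwich C)"
      and "c2 \<equiv> (A = prod_set (prod_set A C) A)"
      and "c3 \<equiv> (A = prod_set (prod_set A (comm_set C C)) A)"
      and "c4 \<equiv> (A = ring_gen {commutator x y | x y. x \<in> A \<and> y \<in> A})"
      and "c5 \<equiv> (A = prod_set C C)"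
      and "c6 \<equiv> \<not> (\<exists>\<phi>::'a \<Rightarrow> complex. is_character \<phi>)"
  shows "(c1 \<longleftrightarrow> c2) \<and> (c2 \<longleftrightarrow> c3) \<and> (c3 \<longleftrightarrow> c4) \<and> (c4 \<longleftrightarrow> c5)
       \<and> (c1 \<longrightarrow> c6)
       \<and> (c6 \<longrightarrow> closure (prod_set (prod_set A C) A) = A)
       \<and> (unital_alg TYPE('a) \<longrightarrow> (c6 \<longrightarrow> c1))"
proof -
  have C: "C = commutators" and A: "A = UNIV" using assms by (simp_all add: C_def)
  have S: "{commutator x y | x y :: 'a. x \<in> UNIV \<and> y \<in> UNIV} = {commutator x y | x y. True}"
    by simp
  have "c1 \<Longrightarrow> c2" unfolding c1_def c2_def C A
    using triple_prod_eq_UNIV_of_sandwich by metis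
  moreover have "c2 \<Longrightarrow> c3" unfolding c2_def c3_def C A
    using triple_prod_comm_commutators_eq_UNIV by metis
  moreover have "c3 \<Longrightarrow> c5" unfolding c3_def c5_def C A
    using prod_commutators_eq_UNIV by metis
  moreover have "c5 \<Longrightarrow> c4" unfolding c4_def c5_def C A S
    by (rule sym, rule ring_gen_eq_UNIV, erule sym)
  moreover have "c4 \<Longrightarrow> c1" unfolding c4_def c1_def C A S
    by (rule sym, rule sandwich_eq_UNIV, erule sym)
  moreover have "c2 \<Longrightarrow> c6" unfolding c2_def c6_def C A
    using no_character_of_triple_prod by metis
  moreover have dense: "closure (prod_set (prod_set A C) A) = A" if c6
    using that closure_triple_prod_commutators unfolding c6_def C A by blast
  moreover have c2 if "unital_alg TYPE('a)" c6
    using dense_ideal_unital[OF that(1) two_sided_ideal_triple_prod] dense[OF that(2)]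
    unfolding c2_def C A by metis
  ultimately show ?thesis by blast
qed

end
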